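(* Let $n\ge2$ and let $f_1,\dots,f_k$ be a generating set of the automorphism group $\mathrm{Aut}(F_n)$ of the free group $F_n$. Consider all words of length $L$ in $f_1,\dots,f_k$, each counted equally. Then the proportion of such words that are irreducible automorphisms tends to $1$ as $L\to\infty$, and the proportion of such words that are strongly irreducible automorphisms also tends to $1$ as $L\to\infty$.
   Context: An automorphism $\phi$ of $F_n$ is irreducible (in the sense of Bestvina–Handel) if there is no $\phi$-invariant (up to conjugacy) proper free factor system of $F_n$. It is strongly irreducible (also called "irreducible with irreducible powers") if there is no integer $m\ge1$ and proper nontrivial free factor $H$ of $F_n$ such that $\phi^m(H)$ is conjugate to $H$. *)

theory Defs
  imports Complex_Main "HOL-Algebra.Group" "HOL-Algebra.Generated_Groups"
begin

text \<open>A letter is (i, True) = x_i or (i, False) = x_i^-1. Elements of F_n are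
 freely reduced words.\<close>

type_synonym fword = "(nat \<times> bool) list"

fun reduced :: "fword \<Rightarrow> bool" where
  "reduced [] = True"
| "reduced [x] = True"
| "reduced (x # y # ys) = (\<not> (fst x = fst y \<and> snd x \<noteq> snd y) \<and> reduced (y # ys))"

fun cancel_cons :: "nat \<times> bool \<Rightarrow> fword \<Rightarrow> fword" where
  "cancel_cons x [] = [x]"
| "cancel_cons x (y # ys) =
     (if fst x = fst y \<and> snd x \<noteq> snd y then ys else x # y # ys)"

definition reduce :: "fword \<Rightarrow> fword" where
  "reduce w = foldr cancel_cons w []"

definition inv_word :: "fword \<Rightarrow> fword" where
  "inv_word w = rev (map (\<lambda>(i, s). (i, \<not> s)) w)"

definition free_group :: "nat \<Rightarrow> fword monoid" where
  "free_group n = \<lparr> carrier = {w. reduced w \<and> (\<forall>x\<in>set w. fst x < n)},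
                    mult = (\<lambda>u v. reduce (u @ v)),
                    one = [] \<rparr>"

definition free_basis :: "nat \<Rightarrow> (nat \<Rightarrow> fword) \<Rightarrow> bool" where
  "free_basis n b \<longleftrightarrow>
     (\<forall>i<n. b i \<in> carrier (free_group n)) \<and>
     bij_betw (\<lambda>w. reduce (concat (map (\<lambda>(i, s). if s then b i else inv_word (b i)) w)))
              (carrier (free_group n)) (carrier (free_group n))"

definition free_factor :: "nat \<Rightarrow> fword set \<Rightarrow> bool" where
  "free_factor n H \<longleftrightarrow>
     (\<exists>b S. free_basis n b \<and> S \<subseteq> {..<n} \<and> H = generate (free_group n) (b ` S))"

definition conj_subgroups :: "('a, 'b) monoid_scheme \<Rightarrow> 'a set \<Rightarrow> 'a set \<Rightarrow> bool" where
  "conj_subgroups G A B \<longleftrightarrow>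
     (\<exists>g\<in>carrier G. B = (\<lambda>h. g \<otimes>\<^bsub>G\<^esub> h \<otimes>\<^bsub>G\<^esub> inv\<^bsub>G\<^esub> g) ` A)"

text \<open>Bestvina--Handel: \<phi> is reducible if there is a basis b and pairwise disjoint
 nonempty index sets S_0..S_(k-1), k \<ge> 1, with F_n = H_0 * ... * H_(k-1) * B,
 H_i = <b ` S_i>, the decomposition proper (not k = 1 with H_0 = F_n), and \<phi>
 permutes the conjugacy classes of the H_i (invariant free factor system).\<close>
definition invariant_proper_ffs :: "nat \<Rightarrow> (fword \<Rightarrow> fword) \<Rightarrow> bool" where
  "invariant_proper_ffs n \<phi> \<longleftrightarrow>
     (\<exists>b (k::nat) S. free_basis n b \<and> k \<ge> 1 \<and>
        (\<forall>i<k. S i \<noteq> {} \<and> S i \<subseteq> {..<n}) \<and>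
        (\<forall>i<k. \<forall>j<k. i \<noteq> j \<longrightarrow> S i \<inter> S j = {}) \<and>
        \<not> (k = 1 \<and> S 0 = {..<n}) \<and>
        (\<forall>i<k. \<exists>j<k. conj_subgroups (free_group n)
            (\<phi> ` generate (free_group n) (b ` S i)) (generate (free_group n) (b ` S j))))"

definition irreducible_aut :: "nat \<Rightarrow> (fword \<Rightarrow> fword) \<Rightarrow> bool" where
  "irreducible_aut n \<phi> \<longleftrightarrow> \<not> invariant_proper_ffs n \<phi>"

definition strongly_irreducible_aut :: "nat \<Rightarrow> (fword \<Rightarrow> fword) \<Rightarrow> bool" where
  "strongly_irreducible_aut n \<phi> \<longleftrightarrow>
     \<not> (\<exists>m\<ge>1. \<exists>H. free_factor n H \<and> H \<noteq> {\<one>\<^bsub>free_group n\<^esub>} \<and>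
            H \<noteq> carrier (free_group n) \<and>
            conj_subgroups (free_group n) ((\<phi> ^^ m) ` H) H)"

definition gen_words :: "nat \<Rightarrow> nat \<Rightarrow> (nat \<times> bool) list set" where
  "gen_words k L = {w. length w = L \<and> (\<forall>x\<in>set w. fst x < k)}"

definition eval_aut_word ::
  "nat \<Rightarrow> (nat \<Rightarrow> fword \<Rightarrow> fword) \<Rightarrow> (nat \<times> bool) list \<Rightarrow> fword \<Rightarrow> fword" where
  "eval_aut_word n f w =
     foldr (\<lambda>(i, s) acc. (if s then f i else inv_into (carrier (free_group n)) (f i)) \<circ> acc)
           w id"

end

theory Submission
  imports Defs "Jordan_Normal_Form.Determinant" "HOL-Number_Theory.Cong"
begin

text \<open>An automorphism \<open>\<phi>\<close> of \<open>F\<^sub>n\<close> acts on \<open>\<int>\<^sup>n\<close> by a matrix \<open>M\<close> in \<open>GL\<^sub>n(\<int>)\<close>. If a free factor of rank \<open>r\<close>,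
  \<open>0 < r < n\<close>, is periodic up to conjugacy, then some power of \<open>M\<close> preserves a direct summand of
  rank \<open>r\<close>, so the wedge of a basis of this summand is a periodic vector of the \<open>r\<close>-th tensor power
  of \<open>M\<close>. By a variant of Minkowski's lemma on torsion in congruence subgroups, the period divides
  a number \<open>e\<close> that depends only on \<open>n\<close>. Hence \<open>M\<close> is a zero of the polynomial function
  \<open>\<Prod>\<^sub>r det((M\<^sup>e)\<^sup>\<otimes>\<^sup>r - 1)\<close>, which does not vanish at \<open>diag(2, \<dots>, 2, \<plusminus>2\<^sup>1\<^sup>-\<^sup>n)\<close>.

  A long random word contains, with probability close to 1, a block representing a product
  \<open>E(t\<^sub>1) \<dots> E(t\<^sub>N)\<close> of elementary matrices, in a fixed pattern through which every matrix in \<open>SL\<^sub>n(\<real>)\<close>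
  factors. Conditionally on the rest of the word, \<open>(t\<^sub>1, \<dots>, t\<^sub>N)\<close> is uniformly distributed on a large
  grid, so by the Schwartz--Zippel lemma the polynomial vanishes with small probability.\<close>

section \<open>Free groups and their abelianisation\<close>

text \<open>Abelianising loses information, but only one implication is required: a periodic free
  factor forces an algebraic identity on \<open>M\<close>. The obstacle is that the period is
  unbounded, which would give infinitely many polynomial conditions of growing degree; the uniform
  exponent \<open>e\<close> merges them into a single one, to which a fixed degree bound applies.
  The full tensor power stands in for the exterior power because its entries are plain products. Its
  additional eigenvalues do no harm: a product of \<open>r\<close> diagonal entries of the witness,
  repetitions allowed and \<open>c\<close> of them the exceptional one, has absolute value
  \<open>2^(r - n c)\<close>, and \<open>r - n c\<close> is nonzero for \<open>0 < r < n\<close>.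
  The sign in the witness is that of the determinant of the rest of the word. Over the integers the
  pattern could fail to exist: \<open>SL_2(\<int>)\<close> does not factor through any fixed pattern
  of elementary matrices, while over \<open>\<real>\<close> Gaussian elimination provides one.
  Nothing is lost, since Schwartz--Zippel asks for a nonzero value at any real point and then bounds
  the zeros on the integer grid.\<close>

lemma reduced_ConsD: "reduced (x # w) \<Longrightarrow> reduced w"
  by (cases w) auto

lemma reduced_cancel_cons: "reduced w \<Longrightarrow> reduced (cancel_cons x w)"
  by (cases w) (auto dest: reduced_ConsD)

lemma reduced_foldr: "reduced v \<Longrightarrow> reduced (foldr cancel_cons u v)"
  by (induction u) (auto intro: reduced_cancel_cons)

lemma reduced_reduce [simp]: "reduced (reduce w)"
  by (simp add: reduce_def reduced_foldr)

lemma cancel_cons_reduced: "reduced (x # w) \<Longrightarrow> cancel_cons x w = x # w"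
  by (cases w) auto

lemma reduce_reduced: "reduced w \<Longrightarrow> reduce w = w"
proof (induction w)
  case (Cons x w)
  then show ?case using cancel_cons_reduced[OF Cons.prems] reduced_ConsD[OF Cons.prems]
    by (simp add: reduce_def)
qed (simp add: reduce_def)

lemma reduce_Nil [simp]: "reduce [] = []"
  by (simp add: reduce_def)

lemma reduce_Cons: "reduce (x # w) = cancel_cons x (reduce w)"
  by (simp add: reduce_def)

lemma reduce_append: "reduce (u @ v) = foldr cancel_cons u (reduce v)"
  by (simp add: reduce_def)

text \<open>Van der Waerden's trick: inverse letters act on reduced words by mutually inverse maps,
  and \<open>reduce w\<close> is the action of \<open>w\<close> on \<open>[]\<close>. Associativity
  of the product follows without any confluence argument.\<close>

lemma cancel_cons_cancel_cons:
  assumes "reduced w" "fst x = fst y" "snd x \<noteq> snd y"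
  shows "cancel_cons x (cancel_cons y w) = w"
proof (cases w)
  case (Cons z ws)
  show ?thesis
  proof (cases "fst y = fst z \<and> snd y \<noteq> snd z")
    case True
    then have "x = z" using assms by (auto simp: prod_eq_iff)
    then show ?thesis using True Cons assms(1) by (auto intro: cancel_cons_reduced)
  qed (use Cons assms in auto)
qed (use assms in auto)

lemma foldr_cancel_cons:
  assumes "reduced v"
  shows "foldr cancel_cons (cancel_cons x w) v = cancel_cons x (foldr cancel_cons w v)"
proof (cases w)
  case (Cons y ys)
  then show ?thesis
    using cancel_cons_cancel_cons[OF reduced_foldr[OF assms, of ys], of x y] by auto
qed auto

lemma foldr_reduce: "reduced v \<Longrightarrow> foldr cancel_cons (reduce u) v = foldr cancel_cons u v"
  by (induction u) (auto simp: reduce_Cons foldr_cancel_cons)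

lemma reduce_idem [simp]: "reduce (reduce w) = reduce w"
  by (simp add: reduce_reduced)

lemma reduce_append_left [simp]: "reduce (reduce u @ v) = reduce (u @ v)"
  by (simp add: reduce_append foldr_reduce)

lemma reduce_append_right [simp]: "reduce (u @ reduce v) = reduce (u @ v)"
  by (simp add: reduce_append reduce_reduced)

lemma reduce_append_cong:
  "reduce u = reduce u' \<Longrightarrow> reduce v = reduce v' \<Longrightarrow> reduce (u @ v) = reduce (u' @ v')"
  by (metis reduce_append_left reduce_append_right)

lemma inv_word_Nil [simp]: "inv_word [] = []"
  by (simp add: inv_word_def)

lemma inv_word_Cons: "inv_word (x # w) = inv_word w @ [(fst x, \<not> snd x)]"
  by (simp add: inv_word_def case_prod_unfold)

lemma inv_word_append: "inv_word (u @ v) = inv_word v @ inv_word u"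
  by (simp add: inv_word_def)

lemma inv_word_inv_word [simp]: "inv_word (inv_word w) = w"
  by (induction w) (auto simp: inv_word_Cons inv_word_append)

lemma length_inv_word [simp]: "length (inv_word w) = length w"
  by (simp add: inv_word_def)

lemma fst_set_inv_word: "fst ` set (inv_word w) = fst ` set w"
  by (induction w) (auto simp: inv_word_Cons)

lemma reduce_inv_word_right: "reduce (w @ inv_word w) = []"
proof (induction w)
  case (Cons x w)
  have "reduce ((x # w) @ inv_word (x # w)) = reduce ([x] @ (w @ inv_word w) @ [(fst x, \<not> snd x)])"
    by (simp add: inv_word_Cons)
  also have "\<dots> = reduce ([x] @ reduce (w @ inv_word w) @ [(fst x, \<not> snd x)])"
    by (intro reduce_append_cong) auto
  also have "\<dots> = []"
    unfolding Cons by (simp add: reduce_def)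
  finally show ?case .
qed auto

lemma reduce_inv_word_left: "reduce (inv_word w @ w) = []"
  using reduce_inv_word_right[of "inv_word w"] by simp

lemma set_cancel_cons: "set (cancel_cons x w) \<subseteq> insert x (set w)"
  by (cases w) auto

lemma set_reduce: "set (reduce w) \<subseteq> set w"
  by (induction w) (use set_cancel_cons in \<open>fastforce simp: reduce_Cons\<close>)+

lemma carrier_free_group:
  "w \<in> carrier (free_group n) \<longleftrightarrow> reduced w \<and> (\<forall>x\<in>set w. fst x < n)"
  by (simp add: free_group_def)

lemma mult_free_group [simp]: "u \<otimes>\<^bsub>free_group n\<^esub> v = reduce (u @ v)"
  by (simp add: free_group_def)

lemma one_free_group [simp]: "\<one>\<^bsub>free_group n\<^esub> = []"
  by (simp add: free_group_def)

lemma reduce_in_carrier: "\<forall>x\<in>set w. fst x < n \<Longrightarrow> reduce w \<in> carrier (free_group n)"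
  using set_reduce by (fastforce simp: carrier_free_group)

lemma fst_inv_word_lt: "(\<forall>x\<in>set (inv_word w). fst x < n) \<longleftrightarrow> (\<forall>x\<in>set w. fst x < n)"
  using fst_set_inv_word[of w] by (metis (no_types, opaque_lifting) imageE image_eqI)

lemma group_free_group: "group (free_group n)"
proof (rule groupI)
  fix x y assume "x \<in> carrier (free_group n)" "y \<in> carrier (free_group n)"
  then show "x \<otimes>\<^bsub>free_group n\<^esub> y \<in> carrier (free_group n)"
    unfolding mult_free_group by (intro reduce_in_carrier) (auto simp: carrier_free_group)
next
  fix x assume x: "x \<in> carrier (free_group n)"
  then have "reduce (inv_word x) \<in> carrier (free_group n)"
    by (intro reduce_in_carrier) (simp add: fst_inv_word_lt carrier_free_group)
  moreover have "reduce (inv_word x) \<otimes>\<^bsub>free_group n\<^esub> x = \<one>\<^bsub>free_group n\<^esub>"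
    by (simp add: reduce_inv_word_left)
  ultimately show "\<exists>y\<in>carrier (free_group n). y \<otimes>\<^bsub>free_group n\<^esub> x = \<one>\<^bsub>free_group n\<^esub>" by blast
qed (auto simp: carrier_free_group reduce_reduced)

lemma inv_free_group:
  assumes "x \<in> carrier (free_group n)"
  shows "inv\<^bsub>free_group n\<^esub> x = reduce (inv_word x)"
proof (rule group.inv_equality[OF group_free_group])
  show "reduce (inv_word x) \<in> carrier (free_group n)"
    using assms by (intro reduce_in_carrier) (simp add: fst_inv_word_lt carrier_free_group)
qed (use assms in \<open>auto simp: reduce_inv_word_left\<close>)

section \<open>Substitution homomorphisms and Nielsen automorphisms\<close>

definition subst :: "(nat \<Rightarrow> fword) \<Rightarrow> fword \<Rightarrow> fword" where
  "subst b w = concat (map (\<lambda>(i, s). if s then b i else inv_word (b i)) w)"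

lemma subst_Nil [simp]: "subst b [] = []"
  by (simp add: subst_def)

lemma subst_append: "subst b (u @ v) = subst b u @ subst b v"
  by (simp add: subst_def)

lemma subst_Cons: "subst b (x # w) = subst b [x] @ subst b w"
  by (simp add: subst_def)

lemma subst_letter [simp]: "subst b [(i, s)] = (if s then b i else inv_word (b i))"
  by (simp add: subst_def)

lemma reduce_subst_cancel_cons: "reduce (subst b (cancel_cons x w)) = reduce (subst b (x # w))"
proof (cases w)
  case (Cons y ys)
  show ?thesis
  proof (cases "fst x = fst y \<and> snd x \<noteq> snd y")
    case True
    then have "reduce (subst b [x] @ subst b [y]) = []"
      by (cases x; cases y) (auto simp: reduce_inv_word_left reduce_inv_word_right)
    moreover have "subst b (x # w) = (subst b [x] @ subst b [y]) @ subst b ys"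
      using subst_Cons[of b y ys] subst_Cons[of b x w] by (simp add: Cons)
    ultimately have "reduce (subst b (x # w)) = reduce (subst b ys)"
      by (metis append_Nil reduce_append_left)
    then show ?thesis using True Cons by simp
  qed (use Cons in auto)
qed auto

lemma reduce_subst_reduce: "reduce (subst b (reduce w)) = reduce (subst b w)"
proof (induction w)
  case (Cons x w)
  have "reduce (subst b (reduce (x # w))) = reduce (subst b [x] @ subst b (reduce w))"
    by (metis reduce_Cons reduce_subst_cancel_cons subst_Cons)
  also have "\<dots> = reduce (subst b (x # w))"
    by (subst (2) subst_Cons) (intro reduce_append_cong refl Cons)
  finally show ?case .
qed auto

lemma set_subst_lt:
  assumes "\<forall>i<n. \<forall>x\<in>set (b i). fst x < n" "\<forall>x\<in>set w. fst x < n"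
  shows "\<forall>x\<in>set (subst b w). fst x < n"
  using assms(2)
proof (induction w)
  case (Cons x w)
  then have "\<forall>y\<in>set (subst b [x]). fst y < n"
    using assms(1) by (cases x) (auto simp: fst_inv_word_lt)
  then show ?case using Cons by (subst subst_Cons) auto
qed auto

lemma reduce_subst_hom:
  assumes "\<forall>i<n. \<forall>x\<in>set (b i). fst x < n"
  shows "(\<lambda>w. reduce (subst b w)) \<in> hom (free_group n) (free_group n)"
proof (rule homI)
  fix x assume "x \<in> carrier (free_group n)"
  then show "reduce (subst b x) \<in> carrier (free_group n)"
    by (intro reduce_in_carrier set_subst_lt assms) (auto simp: carrier_free_group)
qed (simp add: reduce_subst_reduce subst_append)

lemma reduce_subst_inverse:
  assumes b: "\<forall>i<n. reduce (subst b' (b i)) = [(i, True)]" and w: "\<forall>x\<in>set w. fst x < n"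
  shows "reduce (subst b' (subst b w)) = reduce w"
  using w
proof (induction w)
  case (Cons x w)
  \<comment> \<open>Letters \<open>(i, False)\<close> are sent to inverses of \<open>b i\<close>.
    Both sides here are inverse to \<open>reduce (subst b' u)\<close>, and inverses are
    unique.\<close>
  have inv: "reduce (subst b' (inv_word u)) = reduce (inv_word (reduce (subst b' u)))" for u
  proof -
    have "reduce (subst b' u @ subst b' (inv_word u)) = []"
      by (metis reduce_inv_word_right reduce_subst_reduce reduce_Nil subst_Nil subst_append)
    then have "reduce (reduce (subst b' u) @ subst b' (inv_word u)) = []" by simp
    then have "reduce (inv_word (reduce (subst b' u)) @ reduce (subst b' u) @ subst b' (inv_word u))
       = reduce (inv_word (reduce (subst b' u)))"
      by (metis append_Nil2 reduce_append_right)
    then show ?thesis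
      by (metis append_Nil append_assoc reduce_append_left reduce_inv_word_left)
  qed
  have "reduce (subst b' (subst b [x])) = [x]"
  proof (cases x)
    case (Pair i s)
    then have "reduce (subst b' (b i)) = [(i, True)]" using b Cons.prems by auto
    then show ?thesis using Pair inv[of "b i"]
      by (cases s) (simp_all add: inv_word_def reduce_def)
  qed
  then have "reduce (subst b' (subst b (x # w))) = reduce ([x] @ w)"
    by (subst subst_Cons, subst subst_append)
       (rule reduce_append_cong, use Cons in \<open>auto simp: reduce_def\<close>)
  then show ?case by simp
qed auto

text \<open>A Nielsen automorphism, multiplying \<open>x_j\<close> on the right by
  \<open>x_i\<close> or its inverse. On the abelianisation it becomes an elementary matrix; the sign
  \<open>s\<close> allows the inverse to be written down.\<close>

definition transv :: "nat \<Rightarrow> nat \<Rightarrow> bool \<Rightarrow> nat \<Rightarrow> fword" where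
  "transv i j s k = (if k = j then [(j, True), (i, s)] else [(k, True)])"

lemma transv_iso:
  assumes "i < n" "j < n" "i \<noteq> j"
  shows "(\<lambda>w. reduce (subst (transv i j True) w)) \<in> iso (free_group n) (free_group n)"
proof -
  let ?f = "\<lambda>s w. reduce (subst (transv i j s) w)"
  have lt: "\<forall>k<n. \<forall>x\<in>set (transv i j s k). fst x < n" for s
    using assms by (auto simp: transv_def)
  have id: "?f s (?f (\<not> s) w) = w" if "w \<in> carrier (free_group n)" for s w
  proof -
    have "?f s (?f (\<not> s) w) = reduce w"
      unfolding reduce_subst_reduce
    proof (rule reduce_subst_inverse)
      show "\<forall>k<n. reduce (subst (transv i j s) (transv i j (\<not> s) k)) = [(k, True)]"
        using assms by (cases s) (auto simp: transv_def subst_def reduce_def inv_word_def)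
    qed (use that in \<open>auto simp: carrier_free_group\<close>)
    then show ?thesis using that by (simp add: carrier_free_group reduce_reduced)
  qed
  have hom: "?f s \<in> hom (free_group n) (free_group n)" for s
    by (rule reduce_subst_hom[OF lt])
  have "bij_betw (?f True) (carrier (free_group n)) (carrier (free_group n))"
    by (rule bij_betw_byWitness[where f' = "?f False"])
       (use id[of _ True] id[of _ False] hom in \<open>auto simp: hom_def Pi_iff\<close>)
  then show ?thesis using hom by (simp add: iso_def)
qed

text \<open>\<open>expo i w\<close> is the exponent sum of \<open>x\<^sub>i\<close>, that is, the \<open>i\<close>-th coordinate in the abelianisation.\<close>

definition expo :: "nat \<Rightarrow> fword \<Rightarrow> int" where
  "expo i w = (\<Sum>x\<leftarrow>w. if fst x = i then (if snd x then 1 else -1) else 0)"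

lemma expo_Nil [simp]: "expo i [] = 0"
  by (simp add: expo_def)

lemma expo_letter: "expo i [x] = (if fst x = i then (if snd x then 1 else -1) else 0)"
  by (simp add: expo_def)

lemma expo_append [simp]: "expo i (u @ v) = expo i u + expo i v"
  by (simp add: expo_def)

lemma expo_Cons: "expo i (x # w) = expo i [x] + expo i w"
  by (simp add: expo_def)

lemma expo_cancel_cons: "expo i (cancel_cons x w) = expo i (x # w)"
  by (cases w) (auto simp: expo_def)

lemma expo_reduce [simp]: "expo i (reduce w) = expo i w"
proof (induction w)
  case (Cons x w)
  then show ?case using expo_Cons[of i x w] expo_Cons[of i x "reduce w"]
    by (simp add: reduce_Cons expo_cancel_cons)
qed auto

lemma expo_inv_word [simp]: "expo i (inv_word w) = - expo i w"
proof (induction w)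
  case (Cons x w)
  then show ?case using expo_Cons[of i x w] by (auto simp: inv_word_Cons expo_letter)
qed auto

text \<open>The universal property of the abelianisation: an additive map to \<int> is determined by
  its values on the generators. Tails of reduced words are reduced, so induction on the word stays
  inside the carrier.\<close>

lemma additive_eq_expo:
  assumes add: "\<And>u v. u \<in> carrier (free_group n) \<Longrightarrow> v \<in> carrier (free_group n)
      \<Longrightarrow> h (reduce (u @ v)) = h u + (h v :: int)"
    and w: "w \<in> carrier (free_group n)"
  shows "h w = (\<Sum>j<n. h [(j, True)] * expo j w)"
  using w
proof (induction w)
  have nil: "[] \<in> carrier (free_group n)" by (simp add: carrier_free_group)
  case Nil
  then show ?case using add[OF nil nil] by simp
next
  case (Cons x w)
  have nil: "[] \<in> carrier (free_group n)" by (simp add: carrier_free_group)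
  have h0: "h [] = 0" using add[OF nil nil] by simp
  have w: "w \<in> carrier (free_group n)" using Cons.prems by (auto simp: carrier_free_group dest: reduced_ConsD)
  obtain i s where x: "x = (i, s)" by force
  have i: "i < n" using Cons.prems x by (simp add: carrier_free_group)
  have c: "[(i, t)] \<in> carrier (free_group n)" for t using i by (simp add: carrier_free_group)
  have "h [(i, True)] + h [(i, False)] = 0"
    using add[OF c c, of True False] by (simp add: reduce_def h0)
  then have hx: "h [x] = h [(i, True)] * expo i [x]"
    by (cases s) (auto simp: x expo_letter)
  have "(\<Sum>j<n. h [(j, True)] * expo j [x]) = (\<Sum>j<n. if j = i then h [(i, True)] * expo i [x] else 0)"
    by (rule sum.cong) (auto simp: expo_letter x)
  then have "(\<Sum>j<n. h [(j, True)] * expo j [x]) = h [x]"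
    using i hx by simp
  moreover have "h (x # w) = h [x] + h w"
    using add[OF c[of s] w] Cons.prems by (simp add: x carrier_free_group reduce_reduced)
  ultimately show ?case
    using Cons.IH[OF w] by (subst expo_Cons) (simp add: distrib_left sum.distrib)
qed

definition abel :: "nat \<Rightarrow> fword \<Rightarrow> int vec" where
  "abel n w = vec n (\<lambda>i. expo i w)"

definition abel_mat :: "nat \<Rightarrow> (fword \<Rightarrow> fword) \<Rightarrow> int mat" where
  "abel_mat n \<phi> = mat n n (\<lambda>(i, j). expo i (\<phi> [(j, True)]))"

lemma abel_carrier [simp]: "abel n w \<in> carrier_vec n"
  by (simp add: abel_def)

lemma abel_mat_carrier [simp]: "abel_mat n \<phi> \<in> carrier_mat n n"
  by (simp add: abel_mat_def)

lemma abel_hom: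
  assumes "\<phi> \<in> hom (free_group n) (free_group n)" "w \<in> carrier (free_group n)"
  shows "abel n (\<phi> w) = abel_mat n \<phi> *\<^sub>v abel n w"
proof -
  have "expo i (\<phi> w) = (\<Sum>j<n. expo i (\<phi> [(j, True)]) * expo j w)" for i
    by (rule additive_eq_expo[where h = "\<lambda>w. expo i (\<phi> w)"])
       (use assms in \<open>auto simp: hom_def\<close>)
  then show ?thesis
    by (auto simp: abel_def abel_mat_def scalar_prod_def atLeast0LessThan intro!: eq_vecI sum.cong)
qed

lemma gen_in_carrier [simp]: "j < n \<Longrightarrow> [(j, s)] \<in> carrier (free_group n)"
  by (simp add: carrier_free_group)

lemma col_abel_mat: "j < n \<Longrightarrow> col (abel_mat n \<phi>) j = abel n (\<phi> [(j, True)])"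
  by (auto simp: abel_mat_def abel_def)

lemma abel_mat_comp:
  assumes "\<phi> \<in> hom (free_group n) (free_group n)" "\<psi> \<in> hom (free_group n) (free_group n)"
  shows "abel_mat n (\<phi> \<circ> \<psi>) = abel_mat n \<phi> * abel_mat n \<psi>"
proof (rule eq_matI)
  fix i j assume ij: "i < dim_row (abel_mat n \<phi> * abel_mat n \<psi>)" "j < dim_col (abel_mat n \<phi> * abel_mat n \<psi>)"
  then have lt: "i < n" "j < n" by (simp_all add: abel_mat_def)
  have c: "\<psi> [(j, True)] \<in> carrier (free_group n)"
    using assms(2) gen_in_carrier[OF lt(2), of True] by (auto simp: hom_def Pi_iff)
  have "abel_mat n (\<phi> \<circ> \<psi>) $$ (i, j) = abel n (\<phi> (\<psi> [(j, True)])) $ i"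
    using lt by (simp add: abel_mat_def abel_def)
  also have "\<dots> = (abel_mat n \<phi> *\<^sub>v col (abel_mat n \<psi>) j) $ i"
    using abel_hom[OF assms(1) c] col_abel_mat[OF lt(2), of \<psi>] by simp
  also have "\<dots> = (abel_mat n \<phi> * abel_mat n \<psi>) $$ (i, j)"
    using lt carrier_matD[OF abel_mat_carrier[of n \<phi>]] carrier_matD[OF abel_mat_carrier[of n \<psi>]] by simp
  finally show "abel_mat n (\<phi> \<circ> \<psi>) $$ (i, j) = (abel_mat n \<phi> * abel_mat n \<psi>) $$ (i, j)" .
qed (simp_all add: abel_mat_def)

lemma abel_mat_cong:
  "(\<And>w. w \<in> carrier (free_group n) \<Longrightarrow> \<phi> w = \<psi> w) \<Longrightarrow> abel_mat n \<phi> = abel_mat n \<psi>"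
  by (auto simp: abel_mat_def intro!: eq_matI)

lemma abel_mat_id: "abel_mat n id = 1\<^sub>m n"
  by (auto simp: abel_mat_def expo_letter intro!: eq_matI)

section \<open>Tensor powers and invariant summands of integer matrices\<close>

text \<open>The columns of \<open>C\<close> form a basis of the summand, \<open>W\<close> is a retraction onto it, and \<open>Q\<close> describes the
  action of \<open>N\<close> on it.\<close>

definition preserves_summand :: "nat \<Rightarrow> nat \<Rightarrow> int mat \<Rightarrow> bool" where
  "preserves_summand n r N \<longleftrightarrow> (\<exists>C W Q R. C \<in> carrier_mat n r \<and> W \<in> carrier_mat r n \<and>
     Q \<in> carrier_mat r r \<and> R \<in> carrier_mat r r \<and>
     W * C = 1\<^sub>m r \<and> N * C = C * Q \<and> Q * R = 1\<^sub>m r)"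

lemma pow_mat_add:
  assumes "(A :: 'a :: semiring_1 mat) \<in> carrier_mat n n"
  shows "A ^\<^sub>m (a + b) = A ^\<^sub>m a * A ^\<^sub>m b"
  using assms by (induction b) (auto simp: assoc_mult_mat[of _ n n _ n _ n])

lemma pow_mat_mult:
  assumes "(A :: 'a :: semiring_1 mat) \<in> carrier_mat n n"
  shows "A ^\<^sub>m (a * b) = (A ^\<^sub>m a) ^\<^sub>m b"
proof (induction b)
  case (Suc b)
  have "A ^\<^sub>m (a * Suc b) = A ^\<^sub>m (a * b) * A ^\<^sub>m a"
    using pow_mat_add[OF assms, of "a * b" a] by (simp add: add.commute)
  then show ?case using Suc by simp
qed (use assms in simp)

lemma pow_mat_fix:
  assumes "(A :: 'a :: comm_semiring_1 mat) \<in> carrier_mat n n" "v \<in> carrier_vec n" "A *\<^sub>v v = v"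
  shows "A ^\<^sub>m k *\<^sub>v v = v"
  by (induction k) (use assms in \<open>auto simp: assoc_mult_mat_vec[of _ n n]\<close>)

section \<open>Tensor powers, minors and wedges\<close>

definition funs :: "nat \<Rightarrow> nat \<Rightarrow> (nat \<Rightarrow> nat) set" where
  "funs r n = {..<r} \<rightarrow>\<^sub>E {..<n}"

lemma finite_funs [simp]: "finite (funs r n)"
  by (auto simp: funs_def intro: finite_PiE)

text \<open>Matrix rows and columns are numbered, so the multi-indices are put in an arbitrary fixed
  order; only bijectivity matters.\<close>

definition enum_funs :: "nat \<Rightarrow> nat \<Rightarrow> nat \<Rightarrow> nat \<Rightarrow> nat" where
  "enum_funs r n = (SOME h. bij_betw h {..<card (funs r n)} (funs r n))"

lemma bij_enum_funs: "bij_betw (enum_funs r n) {..<card (funs r n)} (funs r n)"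
  unfolding enum_funs_def
  by (rule someI_ex[where P = "\<lambda>h. bij_betw h {..<card (funs r n)} (funs r n)"])
     (use ex_bij_betw_nat_finite[OF finite_funs, of r n] in \<open>simp add: atLeast0LessThan\<close>)

lemma enum_funs_in: "x < card (funs r n) \<Longrightarrow> enum_funs r n x \<in> funs r n"
  using bij_enum_funs[of r n] by (auto simp: bij_betw_def)

lemma enum_funs_lt: "x < card (funs r n) \<Longrightarrow> i < r \<Longrightarrow> enum_funs r n x i < n"
  using enum_funs_in[of x r n] by (auto simp: funs_def PiE_iff)

lemma enum_funs_eq_iff:
  assumes "x < card (funs r n)" "y < card (funs r n)"
  shows "x = y \<longleftrightarrow> (\<forall>i<r. enum_funs r n x i = enum_funs r n y i)"
proof
  assume "\<forall>i<r. enum_funs r n x i = enum_funs r n y i"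
  then have "enum_funs r n x = enum_funs r n y"
    using enum_funs_in[OF assms(1)] enum_funs_in[OF assms(2)]
    unfolding funs_def by - (rule PiE_ext, auto)
  then show "x = y" using bij_enum_funs[of r n] assms by (auto simp: bij_betw_def inj_on_def)
qed auto

text \<open>The matrix of the \<open>r\<close>-th tensor power of \<open>M\<close>, whose rows and columns are indexed by the
  functions from \<open>{..<r}\<close> to \<open>{..<n}\<close>.\<close>

definition tensor :: "nat \<Rightarrow> nat \<Rightarrow> 'a :: comm_ring_1 mat \<Rightarrow> 'a mat" where
  "tensor r n M = mat (card (funs r n)) (card (funs r n))
     (\<lambda>(x, y). \<Prod>i<r. M $$ (enum_funs r n x i, enum_funs r n y i))"

lemma tensor_carrier [simp]: "tensor r n M \<in> carrier_mat (card (funs r n)) (card (funs r n))"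
  by (simp add: tensor_def)

text \<open>Multiplying out a product of \<open>r\<close> sums gives a sum over choice functions,
  and these are exactly the indices of the tensor power.\<close>

lemma tensor_mult:
  assumes A: "A \<in> carrier_mat n n" and B: "B \<in> carrier_mat n n"
  shows "tensor r n (A * B) = tensor r n A * tensor r n B"
proof (rule eq_matI)
  let ?e = "enum_funs r n" and ?D = "card (funs r n)"
  fix x y assume "x < dim_row (tensor r n A * tensor r n B)" "y < dim_col (tensor r n A * tensor r n B)"
  then have xy: "x < ?D" "y < ?D" by (simp_all add: tensor_def)
  have "tensor r n (A * B) $$ (x, y) = (\<Prod>i<r. \<Sum>c<n. A $$ (?e x i, c) * B $$ (c, ?e y i))"
    using xy A B enum_funs_lt
    by (auto simp: tensor_def scalar_prod_def atLeast0LessThan intro!: prod.cong sum.cong)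
  also have "\<dots> = (\<Sum>g\<in>funs r n. \<Prod>i<r. A $$ (?e x i, g i) * B $$ (g i, ?e y i))"
    unfolding funs_def by (rule prod_sum_PiE) auto
  also have "\<dots> = (\<Sum>z<?D. \<Prod>i<r. A $$ (?e x i, ?e z i) * B $$ (?e z i, ?e y i))"
    by (rule sum.reindex_bij_betw[OF bij_enum_funs, symmetric])
  also have "\<dots> = (tensor r n A * tensor r n B) $$ (x, y)"
    using xy by (auto simp: tensor_def scalar_prod_def atLeast0LessThan prod.distrib intro!: sum.cong)
  finally show "tensor r n (A * B) $$ (x, y) = (tensor r n A * tensor r n B) $$ (x, y)" .
qed (simp_all add: tensor_def)

lemma tensor_one: "tensor r n (1\<^sub>m n) = 1\<^sub>m (card (funs r n))"
proof (rule eq_matI)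
  let ?e = "enum_funs r n" and ?D = "card (funs r n)"
  fix x y assume "x < dim_row (1\<^sub>m ?D :: 'a mat)" "y < dim_col (1\<^sub>m ?D :: 'a mat)"
  then have xy: "x < ?D" "y < ?D" by auto
  have "tensor r n (1\<^sub>m n) $$ (x, y) = (\<Prod>i<r. if ?e x i = ?e y i then 1 else 0 :: 'a)"
    using xy enum_funs_lt by (auto simp: tensor_def intro!: prod.cong)
  also have "\<dots> = 1\<^sub>m ?D $$ (x, y)"
    using enum_funs_eq_iff[OF xy] xy by (auto intro!: prod_zero)
  finally show "tensor r n (1\<^sub>m n) $$ (x, y) = (1\<^sub>m ?D $$ (x, y) :: 'a)" .
qed (simp_all add: tensor_def)

lemma tensor_pow:
  assumes "A \<in> carrier_mat n n"
  shows "tensor r n (A ^\<^sub>m k) = tensor r n A ^\<^sub>m k"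
  using assms by (induction k) (auto simp: tensor_one tensor_mult carrier_matD[OF tensor_carrier])

text \<open>A Pluecker coordinate of the column span of \<open>C\<close>; the chosen rows may come
  in any order and may repeat.\<close>

definition rows_det :: "nat \<Rightarrow> 'a :: comm_ring_1 mat \<Rightarrow> (nat \<Rightarrow> nat) \<Rightarrow> 'a" where
  "rows_det r C a = det (mat r r (\<lambda>(i, j). C $$ (a i, j)))"

text \<open>The Cauchy--Binet formula before terms are grouped by sets of rows. Summing over all
  functions \<open>f\<close> leaves a plain product of entries of \<open>M\<close>, that is, an
  entry of the tensor power.\<close>

lemma rows_det_mult:
  assumes M: "M \<in> carrier_mat m n" and C: "C \<in> carrier_mat n r" and a: "\<And>i. i < r \<Longrightarrow> a i < m"
  shows "rows_det r (M * C) a = (\<Sum>f\<in>funs r n. (\<Prod>i<r. M $$ (a i, f i)) * rows_det r C f)"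
proof -
  let ?P = "{p. p permutes {0..<r}}"
  have "rows_det r (M * C) a = (\<Sum>p\<in>?P. signof p * (\<Prod>i<r. (M * C) $$ (a i, p i)))"
    unfolding rows_det_def
    by (subst det_def'[of _ r]) (auto simp: atLeast0LessThan intro!: sum.cong prod.cong)
  also have "\<dots> = (\<Sum>p\<in>?P. \<Sum>f\<in>funs r n. signof p * (\<Prod>i<r. M $$ (a i, f i) * C $$ (f i, p i)))"
  proof (rule sum.cong[OF refl])
    fix p assume p: "p \<in> ?P"
    have "(\<Prod>i<r. (M * C) $$ (a i, p i)) = (\<Prod>i<r. \<Sum>c<n. M $$ (a i, c) * C $$ (c, p i))"
    proof (rule prod.cong[OF refl])
      fix i assume "i \<in> {..<r}"
      then have "p i < r" "i < r" using p permutes_in_image[of p "{0..<r}" i] by auto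
      then show "(M * C) $$ (a i, p i) = (\<Sum>c<n. M $$ (a i, c) * C $$ (c, p i))"
        using M C a by (simp add: scalar_prod_def atLeast0LessThan)
    qed
    also have "\<dots> = (\<Sum>f\<in>funs r n. \<Prod>i<r. M $$ (a i, f i) * C $$ (f i, p i))"
      unfolding funs_def by (rule prod_sum_PiE) auto
    finally show "signof p * (\<Prod>i<r. (M * C) $$ (a i, p i)) =
        (\<Sum>f\<in>funs r n. signof p * (\<Prod>i<r. M $$ (a i, f i) * C $$ (f i, p i)))"
      by (simp add: sum_distrib_left)
  qed
  also have "\<dots> = (\<Sum>f\<in>funs r n. \<Sum>p\<in>?P. (\<Prod>i<r. M $$ (a i, f i)) * (signof p * (\<Prod>i<r. C $$ (f i, p i))))"
    by (subst sum.swap) (simp add: prod.distrib mult_ac)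
  also have "\<dots> = (\<Sum>f\<in>funs r n. (\<Prod>i<r. M $$ (a i, f i)) * rows_det r C f)"
  proof (rule sum.cong[OF refl])
    fix f
    have "rows_det r C f = (\<Sum>p\<in>?P. signof p * (\<Prod>i<r. C $$ (f i, p i)))"
      unfolding rows_det_def
      by (subst det_def'[of _ r]) (auto simp: atLeast0LessThan intro!: sum.cong prod.cong)
    then show "(\<Sum>p\<in>?P. (\<Prod>i<r. M $$ (a i, f i)) * (signof p * (\<Prod>i<r. C $$ (f i, p i)))) =
       (\<Prod>i<r. M $$ (a i, f i)) * rows_det r C f"
      by (simp add: sum_distrib_left)
  qed
  finally show ?thesis .
qed

text \<open>The wedge of the columns of \<open>C\<close>, as an antisymmetric tensor.\<close>

definition wedge :: "nat \<Rightarrow> nat \<Rightarrow> 'a :: comm_ring_1 mat \<Rightarrow> 'a vec" where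
  "wedge r n C = vec (card (funs r n)) (\<lambda>x. rows_det r C (enum_funs r n x))"

lemma wedge_carrier [simp]: "wedge r n C \<in> carrier_vec (card (funs r n))"
  by (simp add: wedge_def)

lemma tensor_wedge:
  assumes M: "M \<in> carrier_mat n n" and C: "C \<in> carrier_mat n r"
  shows "tensor r n M *\<^sub>v wedge r n C = wedge r n (M * C)"
proof (rule eq_vecI)
  let ?e = "enum_funs r n" and ?D = "card (funs r n)"
  fix x assume "x < dim_vec (wedge r n (M * C))"
  then have x: "x < ?D" by (simp add: wedge_def)
  have "wedge r n (M * C) $ x = (\<Sum>f\<in>funs r n. (\<Prod>i<r. M $$ (?e x i, f i)) * rows_det r C f)"
    using x rows_det_mult[OF M C] enum_funs_lt by (simp add: wedge_def)
  also have "\<dots> = (\<Sum>y<?D. (\<Prod>i<r. M $$ (?e x i, ?e y i)) * rows_det r C (?e y))"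
    by (rule sum.reindex_bij_betw[OF bij_enum_funs, symmetric])
  also have "\<dots> = (tensor r n M *\<^sub>v wedge r n C) $ x"
    using x by (simp add: tensor_def wedge_def scalar_prod_def atLeast0LessThan)
  finally show "(tensor r n M *\<^sub>v wedge r n C) $ x = wedge r n (M * C) $ x" by simp
qed (simp add: tensor_def wedge_def)

lemma wedge_mult:
  assumes C: "C \<in> carrier_mat n r" and Q: "Q \<in> carrier_mat r r"
  shows "wedge r n (C * Q) = det Q \<cdot>\<^sub>v wedge r n C"
proof (rule eq_vecI)
  let ?e = "enum_funs r n" and ?D = "card (funs r n)"
  fix x assume "x < dim_vec (det Q \<cdot>\<^sub>v wedge r n C)"
  then have x: "x < ?D" by (simp add: wedge_def)
  have "mat r r (\<lambda>(i, j). (C * Q) $$ (?e x i, j)) = mat r r (\<lambda>(i, j). C $$ (?e x i, j)) * Q"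
    using C Q enum_funs_lt[OF x] by (intro eq_matI) (auto simp: scalar_prod_def)
  then have "rows_det r (C * Q) (?e x) = rows_det r C (?e x) * det Q"
    unfolding rows_det_def by (simp add: det_mult[of _ r] Q)
  then show "wedge r n (C * Q) $ x = (det Q \<cdot>\<^sub>v wedge r n C) $ x"
    using x by (simp add: wedge_def)
qed (simp add: wedge_def)

text \<open>The determinant of \<open>W * C\<close> is 1 and is also a linear combination of the
  coordinates of the wedge, so these cannot all vanish.\<close>

lemma wedge_nonzero:
  assumes C: "C \<in> carrier_mat n r" and W: "W \<in> carrier_mat r n" and WC: "W * C = 1\<^sub>m r"
  shows "wedge r n C \<noteq> (0\<^sub>v (card (funs r n)) :: 'a :: comm_ring_1 vec)"
proof
  assume 0: "wedge r n C = 0\<^sub>v (card (funs r n))"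
  have zero: "rows_det r C f = 0" if f: "f \<in> funs r n" for f
  proof -
    obtain x where "x < card (funs r n)" "f = enum_funs r n x"
      using f bij_enum_funs[of r n] by (auto simp: bij_betw_def)
    then show ?thesis using arg_cong[OF 0, of "\<lambda>v. v $ x"] by (simp add: wedge_def)
  qed
  have "mat r r (\<lambda>(i, j). (1\<^sub>m r :: 'a mat) $$ (i, j)) = 1\<^sub>m r" by (intro eq_matI) auto
  then have "rows_det r (1\<^sub>m r) (\<lambda>i. i) = (1 :: 'a)" by (simp add: rows_det_def)
  moreover have "rows_det r (W * C) (\<lambda>i. i) = 0"
    using rows_det_mult[OF W C, of "\<lambda>i. i"] zero by simp
  ultimately show False using WC by simp
qed

section \<open>Congruences and vectors fixed by a power\<close>

abbreviation modm :: "int \<Rightarrow> int mat \<Rightarrow> int mat" where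
  "modm q \<equiv> map_mat (\<lambda>x. x mod q)"

lemma modm_eq_iff:
  assumes "A \<in> carrier_mat n m" "B \<in> carrier_mat n m"
  shows "modm q A = modm q B \<longleftrightarrow> (\<forall>i<n. \<forall>j<m. [A $$ (i, j) = B $$ (i, j)] (mod q))"
  using assms by (auto simp: mat_eq_iff cong_def)

lemma modm_mult:
  assumes "A \<in> carrier_mat n m" "A' \<in> carrier_mat n m" "B \<in> carrier_mat m l" "B' \<in> carrier_mat m l"
    and "modm q A = modm q A'" "modm q B = modm q B'"
  shows "modm q (A * B) = modm q (A' * B')"
proof -
  have "\<forall>i<n. \<forall>j<l. [(A * B) $$ (i, j) = (A' * B') $$ (i, j)] (mod q)"
    using assms by (auto simp: scalar_prod_def modm_eq_iff intro!: cong_sum cong_mult)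
  then show ?thesis using assms by (subst modm_eq_iff[of _ n l]) auto
qed

lemma modm_pow_one:
  assumes "A \<in> carrier_mat n n" "modm q A = modm q (1\<^sub>m n)"
  shows "modm q (A ^\<^sub>m k) = modm q (1\<^sub>m n)"
proof (induction k)
  case (Suc k)
  then show ?case
    using modm_mult[of "A ^\<^sub>m k" n n "1\<^sub>m n" A n "1\<^sub>m n" q] assms by simp
qed (use assms in simp)

lemma modm_dvd:
  assumes "A \<in> carrier_mat n m" "B \<in> carrier_mat n m" "modm q A = modm q B" "p dvd q"
  shows "modm p A = modm p B"
  using assms by (auto simp: modm_eq_iff intro: cong_dvd_modulus)

lemma modm_tensor_one:
  assumes "A \<in> carrier_mat n n" "modm q A = modm q (1\<^sub>m n)"
  shows "modm q (tensor r n A) = modm q (1\<^sub>m (card (funs r n)))"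
proof -
  have "\<forall>i<n. \<forall>j<n. [A $$ (i, j) = 1\<^sub>m n $$ (i, j)] (mod q)"
    using assms modm_eq_iff[of A n n "1\<^sub>m n" q] by (simp del: index_one_mat)
  then have "modm q (tensor r n A) = modm q (tensor r n (1\<^sub>m n))"
    by (subst modm_eq_iff[OF tensor_carrier tensor_carrier])
       (auto simp: tensor_def enum_funs_lt simp del: index_one_mat intro!: cong_prod)
  then show ?thesis by (simp add: tensor_one)
qed

text \<open>There are finitely many residue matrices, so two of the powers with exponents up to
  \<open>card X\<close> agree modulo \<open>q\<close>. Cancelling with \<open>M'\<close> gives a
  period \<open>d \<le> card X\<close>, and \<open>fact (card X)\<close> is a common multiple of all
  such periods, whatever \<open>M\<close> is.\<close>

lemma uniform_exponent_mod:
  assumes "q > 0"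
  shows "\<exists>e\<ge>1. \<forall>M\<in>carrier_mat n n. \<forall>M'\<in>carrier_mat n n.
    M' * M = 1\<^sub>m n \<longrightarrow> modm q (M ^\<^sub>m e) = modm q (1\<^sub>m n)"
proof -
  define X where "X = (\<lambda>g. mat n n g) ` ({..<n} \<times> {..<n} \<rightarrow>\<^sub>E {0..<q})"
  have fin: "finite X" unfolding X_def by (intro finite_imageI finite_PiE) auto
  have X: "modm q A \<in> X" if "A \<in> carrier_mat n n" for A
    unfolding X_def
    by (rule image_eqI[where x = "restrict (\<lambda>ij. A $$ ij mod q) ({..<n} \<times> {..<n})"])
       (use that assms in \<open>auto intro!: eq_matI\<close>)
  have "modm q (M ^\<^sub>m fact (card X)) = modm q (1\<^sub>m n)"
    if M: "M \<in> carrier_mat n n" "M' \<in> carrier_mat n n" and inv: "M' * M = 1\<^sub>m n" for M M'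
  proof -
    have "\<not> inj_on (\<lambda>i. modm q (M ^\<^sub>m i)) {..card X}"
      by (rule pigeonhole)
         (use X[of "M ^\<^sub>m _"] M card_mono[OF fin, of "(\<lambda>i. modm q (M ^\<^sub>m i)) ` {..card X}"] in \<open>force simp: less_Suc_eq_le\<close>)
    then obtain a b where ab: "a < b" "b \<le> card X" "modm q (M ^\<^sub>m a) = modm q (M ^\<^sub>m b)"
      by (auto simp: inj_on_def) (metis linorder_neqE_nat)
    define d where "d = b - a"
    have inva: "M' ^\<^sub>m a * M ^\<^sub>m a = 1\<^sub>m n" for a
    proof (induction a)
      case (Suc a)
      have Mc: "M ^\<^sub>m Suc a = M * M ^\<^sub>m a" using pow_mat_add[OF M(1), of 1 a] M by simp
      have "M' ^\<^sub>m Suc a * M ^\<^sub>m Suc a = M' ^\<^sub>m a * (M' * (M * M ^\<^sub>m a))"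
        unfolding Mc using M by (simp add: assoc_mult_mat[of _ n n _ n _ n])
      also have "M' * (M * M ^\<^sub>m a) = (M' * M) * M ^\<^sub>m a"
        using M by (simp add: assoc_mult_mat[of _ n n _ n _ n])
      finally show ?case using inv Suc M by simp
    qed (use M in simp)
    have "M' ^\<^sub>m a * M ^\<^sub>m b = M ^\<^sub>m d"
    proof -
      have "M ^\<^sub>m b = M ^\<^sub>m a * M ^\<^sub>m d" using pow_mat_add[OF M(1), of a d] ab by (simp add: d_def)
      then have "M' ^\<^sub>m a * M ^\<^sub>m b = (M' ^\<^sub>m a * M ^\<^sub>m a) * M ^\<^sub>m d"
        using M by (simp add: assoc_mult_mat[of _ n n _ n _ n])
      then show ?thesis using inva M by simp
    qed
    moreover have "modm q (M' ^\<^sub>m a * M ^\<^sub>m a) = modm q (M' ^\<^sub>m a * M ^\<^sub>m b)"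
      by (rule modm_mult[of _ n n _ _ n]) (use M ab in auto)
    ultimately have d: "modm q (M ^\<^sub>m d) = modm q (1\<^sub>m n)" using inva by simp
    have "d dvd fact (card X)" using ab by (intro dvd_fact) (auto simp: d_def)
    then obtain c where "fact (card X) = d * c" by (auto simp: dvd_def)
    then show ?thesis using modm_pow_one[OF _ d, of c] M pow_mat_mult[OF M(1)] by simp
  qed
  then show ?thesis by (intro exI[of _ "fact (card X)"]) (simp add: fact_ge_1)
qed

text \<open>Infinite descent: modulo \<open>p\<close> the matrix is an invertible scalar, so a
  kernel vector is divisible by \<open>p\<close>, and the quotient is again in the kernel. Hence all
  its entries are divisible by every power of \<open>p\<close>.\<close>

lemma kernel_trivial_mod_prime:
  assumes S: "S \<in> carrier_mat n n" "modm p S = modm p (c \<cdot>\<^sub>m 1\<^sub>m n)" and p: "prime p" "\<not> p dvd c"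
    and w: "w \<in> carrier_vec n" "S *\<^sub>v w = 0\<^sub>v n"
  shows "w = (0\<^sub>v n :: int vec)"
proof -
  have cong: "[S $$ (i, j) = (if i = j then c else 0)] (mod p)" if "i < n" "j < n" for i j
  proof -
    have "[S $$ (i, j) = (c \<cdot>\<^sub>m 1\<^sub>m n) $$ (i, j)] (mod p)"
      using S that modm_eq_iff[of S n n "c \<cdot>\<^sub>m 1\<^sub>m n" p] by simp
    then show ?thesis using that by (cases "i = j") simp_all
  qed
  have *: "\<forall>i<n. p ^ a dvd w $ i" if "w \<in> carrier_vec n" "S *\<^sub>v w = 0\<^sub>v n" for a w
    using that
  proof (induction a arbitrary: w)
    case (Suc a)
    have eq: "(\<Sum>j<n. S $$ (i, j) * w $ j) = 0" if "i < n" for i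
      using arg_cong[OF Suc.prems(2), of "\<lambda>v. v $ i"] that S(1) Suc.prems(1)
      by (simp add: scalar_prod_def atLeast0LessThan)
    have "p dvd w $ i" if i: "i < n" for i
    proof -
      have "[(\<Sum>j<n. S $$ (i, j) * w $ j) = (\<Sum>j<n. (if i = j then c else 0) * w $ j)] (mod p)"
        by (intro cong_sum cong_mult cong i) auto
      also have "(\<Sum>j<n. (if i = j then c else 0) * w $ j) = (\<Sum>j<n. if j = i then c * w $ i else 0)"
        by (rule sum.cong) auto
      also have "\<dots> = c * w $ i" using i by simp
      finally have "p dvd c * w $ i" using eq[OF i] cong_0_iff cong_sym by metis
      then show ?thesis using p by (simp add: prime_dvd_mult_iff)
    qed
    then have "\<forall>i<n. \<exists>z. w $ i = p * z" by (auto simp: dvd_def)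
    then obtain z where z: "\<And>i. i < n \<Longrightarrow> w $ i = p * z i" by metis
    have "S *\<^sub>v vec n z = 0\<^sub>v n"
    proof (rule eq_vecI)
      fix i assume "i < dim_vec (0\<^sub>v n :: int vec)"
      then have i: "i < n" by simp
      have "p * (S *\<^sub>v vec n z) $ i = (\<Sum>j<n. S $$ (i, j) * w $ j)"
        using i S by (simp add: scalar_prod_def atLeast0LessThan sum_distrib_left z mult_ac)
      then show "(S *\<^sub>v vec n z) $ i = 0\<^sub>v n $ i" using eq[OF i] p i by auto
    qed (use S in auto)
    then have "\<forall>i<n. p ^ a dvd vec n z $ i" by (intro Suc.IH) auto
    then show ?case using z by auto
  qed simp
  show ?thesis
  proof (rule eq_vecI)
    fix i assume "i < dim_vec (0\<^sub>v n :: int vec)"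
    then have i: "i < n" by simp
    have "w $ i = 0"
    proof (rule ccontr)
      assume nz: "w $ i \<noteq> 0"
      \<comment> \<open>Divisibility by this particular power suffices, since
        \<open>p ^ x > x\<close> for every natural number \<open>x\<close>.\<close>
      have "p ^ nat \<bar>w $ i\<bar> \<le> \<bar>w $ i\<bar>" using *[OF w] i nz by (intro zdvd_imp_le) auto
      moreover have "int (nat \<bar>w $ i\<bar>) < 2 ^ nat \<bar>w $ i\<bar>" by (rule of_nat_less_two_power)
      moreover have "(2 :: int) ^ nat \<bar>w $ i\<bar> \<le> p ^ nat \<bar>w $ i\<bar>"
        using p prime_ge_2_int by (intro power_mono) auto
      ultimately show False by linarith
    qed
    then show "w $ i = 0\<^sub>v n $ i" using i by simp
  qed (use w in simp)
qed

text \<open>The geometric sum, that is, the cofactor in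
  \<open>T^N - 1 = geo T N * (T - 1)\<close>.\<close>

primrec geo :: "'a :: semiring_1 mat \<Rightarrow> nat \<Rightarrow> 'a mat" where
  "geo T 0 = 0\<^sub>m (dim_row T) (dim_row T)"
| "geo T (Suc N) = geo T N + T ^\<^sub>m N"

lemma geo_carrier [simp]: "T \<in> carrier_mat n n \<Longrightarrow> geo T N \<in> carrier_mat n n"
  by (induction N) auto

lemma geo_telescope:
  assumes T: "(T :: int mat) \<in> carrier_mat n n" and v: "v \<in> carrier_vec n"
  shows "geo T N *\<^sub>v (T *\<^sub>v v - v) = T ^\<^sub>m N *\<^sub>v v - v"
proof (induction N)
  case (Suc N)
  have c: "T ^\<^sub>m N *\<^sub>v (T *\<^sub>v v - v) = T ^\<^sub>m Suc N *\<^sub>v v - T ^\<^sub>m N *\<^sub>v v"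
    using T v by (simp add: mult_minus_distrib_mat_vec[of _ n n] assoc_mult_mat_vec[of _ n n])
  have "geo T (Suc N) *\<^sub>v (T *\<^sub>v v - v) = geo T N *\<^sub>v (T *\<^sub>v v - v) + T ^\<^sub>m N *\<^sub>v (T *\<^sub>v v - v)"
    using T v by (simp add: add_mult_distrib_mat_vec[of _ n n])
  then show ?case unfolding Suc c using T v by (auto intro!: eq_vecI)
qed (use T v in \<open>auto intro!: eq_vecI\<close>)

lemma modm_geo:
  assumes T: "T \<in> carrier_mat n n" "modm q T = modm q (1\<^sub>m n)"
  shows "modm q (geo T N) = modm q (int N \<cdot>\<^sub>m 1\<^sub>m n)"
proof (induction N)
  case (Suc N)
  have "[geo T N $$ (i, j) + (T ^\<^sub>m N) $$ (i, j) = int N * 1\<^sub>m n $$ (i, j) + 1\<^sub>m n $$ (i, j)] (mod q)"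
    if "i < n" "j < n" for i j
  proof (rule cong_add)
    show "[geo T N $$ (i, j) = int N * 1\<^sub>m n $$ (i, j)] (mod q)"
      using Suc that T modm_eq_iff[of "geo T N" n n "int N \<cdot>\<^sub>m 1\<^sub>m n" q] by simp
    show "[(T ^\<^sub>m N) $$ (i, j) = 1\<^sub>m n $$ (i, j)] (mod q)"
      using modm_pow_one[OF T, of N] that T modm_eq_iff[of "T ^\<^sub>m N" n n "1\<^sub>m n" q] by simp
  qed
  then show ?case using T
    by (subst modm_eq_iff[of _ n n]) (auto simp: algebra_simps)
qed (use T in \<open>auto intro!: eq_matI\<close>)

text \<open>The geometric sum annihilates \<open>T v - v\<close>. It is congruent to
  \<open>N\<close> times the identity, so it has trivial kernel as soon as \<open>p\<close> does not
  divide \<open>N\<close>.\<close>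

lemma fixed_if_fixed_pow:
  assumes T: "T \<in> carrier_mat n n" "modm p T = modm p (1\<^sub>m n)" and p: "prime p" "\<not> p dvd int N"
    and v: "v \<in> carrier_vec n" "T ^\<^sub>m N *\<^sub>v v = v"
  shows "T *\<^sub>v v = v"
proof -
  have "T *\<^sub>v v - v = 0\<^sub>v n"
  proof (rule kernel_trivial_mod_prime[OF _ modm_geo[OF T, of N] p])
    show "geo T N *\<^sub>v (T *\<^sub>v v - v) = 0\<^sub>v n"
      using geo_telescope[OF T(1) v(1), of N] v by simp
  qed (use T v in auto)
  then have "(T *\<^sub>v v - v) $ i = 0" if "i < n" for i using that by simp
  then have "(T *\<^sub>v v) $ i = v $ i" if "i < n" for i using that T v by force
  then show ?thesis using T v by (intro eq_vecI) auto
qed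

text \<open>A variant of Minkowski's lemma. Two primes are used since the argument for a prime \<open>p\<close> only
  handles exponents that are not divisible by \<open>p\<close>.\<close>

lemma fixed_if_fixed_pow_mod_15:
  assumes T: "T \<in> carrier_mat n n" "modm 15 T = modm 15 (1\<^sub>m n)" and N: "N \<ge> 1"
    and v: "v \<in> carrier_vec n" "T ^\<^sub>m N *\<^sub>v v = v"
  shows "T *\<^sub>v v = v"
proof -
  have T3: "modm 3 T = modm 3 (1\<^sub>m n)" and T5: "modm 5 T = modm 5 (1\<^sub>m n)"
    by (rule modm_dvd[OF T(1) _ T(2)]; simp)+
  have "\<not> is_unit (3 :: nat)" "N \<noteq> 0" using N by auto
  then obtain a N' where N': "N = 3 ^ a * N'" "\<not> 3 dvd N'"
    using multiplicity_decompose'[of N 3] by metis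
  \<comment> \<open>The prime 3 removes the factor \<open>N'\<close>, which it does not divide; the
    remaining exponent is a power of 3 and is left to the prime 5. Any two distinct primes would
    serve.\<close>
  have "T ^\<^sub>m (3 ^ a) *\<^sub>v v = v"
  proof (rule fixed_if_fixed_pow[where p = 3 and N = N' and n = n])
    show "modm 3 (T ^\<^sub>m 3 ^ a) = modm 3 (1\<^sub>m n)" by (rule modm_pow_one[OF T(1) T3])
    show "\<not> (3::int) dvd int N'" using N' int_dvd_int_iff[of 3 N'] by simp
    show "(T ^\<^sub>m 3 ^ a) ^\<^sub>m N' *\<^sub>v v = v" using v N' pow_mat_mult[OF T(1)] by simp
  qed (use T v in auto)
  then show ?thesis
  proof (rule fixed_if_fixed_pow[OF T(1) T5 _ _ v(1), rotated -1])
    show "prime (5::int)" by simp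
    show "\<not> (5::int) dvd int (3 ^ a)"
      using prime_dvd_power[of "5::int" 3 a] by auto
  qed
qed

text \<open>Over \<int> or \<real> this vanishes exactly when, for some \<open>0 < r < n\<close>, a
  product of \<open>r\<close> complex eigenvalues of \<open>M^e\<close>, repetitions allowed, equals
  1. It is a polynomial in the entries of \<open>M\<close>.\<close>

definition resonance :: "nat \<Rightarrow> nat \<Rightarrow> 'a :: comm_ring_1 mat \<Rightarrow> 'a" where
  "resonance n e M = (\<Prod>r = 1..<n. det (tensor r n (M ^\<^sub>m e) - 1\<^sub>m (card (funs r n))))"

lemma resonance_zero:
  assumes M: "M \<in> carrier_mat n n"
    and e: "modm 15 (M ^\<^sub>m e) = modm 15 (1\<^sub>m n)"
    and m: "m \<ge> 1" and r: "0 < r" "r < n" and pres: "preserves_summand n r (M ^\<^sub>m m)"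
  shows "resonance n e M = 0"
proof -
  obtain C W Q R where C: "C \<in> carrier_mat n r" and W: "W \<in> carrier_mat r n"
    and Q: "Q \<in> carrier_mat r r" and R: "R \<in> carrier_mat r r"
    and WC: "W * C = 1\<^sub>m r" and NC: "M ^\<^sub>m m * C = C * Q" and QR: "Q * R = 1\<^sub>m r"
    using pres unfolding preserves_summand_def by blast
  let ?D = "card (funs r n)" and ?v = "wedge r n C"
  have "det Q * det R = 1" using det_mult[OF Q R] QR by simp
  then have "\<bar>det Q\<bar> = 1" by (metis abs_zmult_eq_1 abs_one)
  then have dQ: "det Q * det Q = 1" by (metis abs_mult_self_eq mult_1)
  \<comment> \<open>On the wedge, \<open>M^m\<close> acts by \<open>det Q\<close>, which is 1 or -1.
    Doubling the exponent removes the sign, so that the wedge is really fixed.\<close>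
  have "M ^\<^sub>m (m * 2) * C = M ^\<^sub>m m * (C * Q)"
    using assoc_mult_mat[of "M ^\<^sub>m m" n n "M ^\<^sub>m m" n C r] pow_mat_add[OF M, of m m] M C NC
    by (simp add: mult_2_right)
  also have "\<dots> = C * (Q * Q)"
    using assoc_mult_mat[of "M ^\<^sub>m m" n n C r Q r] assoc_mult_mat[of C n r Q r Q r] M C Q NC by simp
  finally have "tensor r n (M ^\<^sub>m (m * 2)) *\<^sub>v ?v = det (Q * Q) \<cdot>\<^sub>v ?v"
    using tensor_wedge[of "M ^\<^sub>m (m * 2)" n C r] M C Q wedge_mult[OF C, of "Q * Q"] by simp
  then have fix2m: "tensor r n M ^\<^sub>m (m * 2) *\<^sub>v ?v = ?v"
    using det_mult[OF Q Q] dQ by (simp add: tensor_pow[OF M])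
  let ?T = "tensor r n (M ^\<^sub>m e)"
  have "?T *\<^sub>v ?v = ?v"
  proof (rule fixed_if_fixed_pow_mod_15[where N = "m * 2"])
    show "modm 15 ?T = modm 15 (1\<^sub>m ?D)" by (rule modm_tensor_one) (use M e in auto)
    have "?T ^\<^sub>m (m * 2) = (tensor r n M ^\<^sub>m (m * 2)) ^\<^sub>m e"
      by (simp add: tensor_pow[OF M] mult.commute flip: pow_mat_mult[OF tensor_carrier])
    then show "?T ^\<^sub>m (m * 2) *\<^sub>v ?v = ?v"
      using pow_mat_fix[OF _ wedge_carrier fix2m] by simp
  qed (use m in auto)
  then have "(?T - 1\<^sub>m ?D) *\<^sub>v ?v = 0\<^sub>v ?D"
    by (simp add: minus_mult_distrib_mat_vec[of _ ?D ?D])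
  then have "det (?T - 1\<^sub>m ?D) = 0"
    using det_0_iff_vec_prod_zero[of "?T - 1\<^sub>m ?D" ?D] wedge_nonzero[OF C W WC] wedge_carrier
    by (metis minus_carrier_mat one_carrier_mat)
  then show ?thesis unfolding resonance_def using r by (intro prod_zero) auto
qed

lemma resonance_of_int:
  assumes "M \<in> carrier_mat n n"
  shows "resonance n e (map_mat real_of_int M) = real_of_int (resonance n e M)"
proof -
  have t: "tensor r n (map_mat real_of_int M) = map_mat real_of_int (tensor r n M)"
    if "M \<in> carrier_mat n n" for r M
    using that enum_funs_lt by (intro eq_matI) (auto simp: tensor_def intro!: prod.cong)
  have "det (tensor r n (map_mat real_of_int M ^\<^sub>m e) - 1\<^sub>m (card (funs r n))) =
     real_of_int (det (tensor r n (M ^\<^sub>m e) - 1\<^sub>m (card (funs r n))))" for r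
  proof -
    have "tensor r n (map_mat real_of_int M ^\<^sub>m e) - 1\<^sub>m (card (funs r n)) =
       map_mat real_of_int (tensor r n (M ^\<^sub>m e) - 1\<^sub>m (card (funs r n)))"
      using assms t[of "M ^\<^sub>m e" r]
      by (subst of_int_hom.mat_hom_pow[OF assms, symmetric])
         (auto intro!: eq_matI simp: carrier_matD[OF tensor_carrier])
    then show ?thesis by simp
  qed
  then show ?thesis by (simp add: resonance_def)
qed

section \<open>From reducible automorphisms to integer matrices\<close>

lemma eval_aut_word_Nil [simp]: "eval_aut_word n f [] = id"
  by (simp add: eval_aut_word_def)

lemma eval_aut_word_Cons:
  "eval_aut_word n f (x # w) = eval_aut_word n f [x] \<circ> eval_aut_word n f w"
  by (simp add: eval_aut_word_def case_prod_unfold)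

lemma eval_aut_word_append:
  "eval_aut_word n f (u @ v) = eval_aut_word n f u \<circ> eval_aut_word n f v"
proof (induction u)
  case (Cons x u)
  then show ?case
    using eval_aut_word_Cons[of n f x u] eval_aut_word_Cons[of n f x "u @ v"] by (simp add: comp_assoc)
qed simp

lemma eval_aut_word_letter:
  "eval_aut_word n f [(i, s)] = (if s then f i else inv_into (carrier (free_group n)) (f i))"
  by (simp add: eval_aut_word_def)

lemma iso_comp:
  assumes "g \<in> iso G H" "h \<in> iso H K"
  shows "h \<circ> g \<in> iso G K"
  using assms by (auto simp: iso_def intro: hom_compose bij_betw_trans)

lemma eval_aut_word_iso:
  assumes f: "\<forall>i<k. f i \<in> iso (free_group n) (free_group n)" and w: "\<forall>x\<in>set w. fst x < k"
  shows "eval_aut_word n f w \<in> iso (free_group n) (free_group n)"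
  using w
proof (induction w)
  case (Cons x w)
  obtain i s where x: "x = (i, s)" by force
  have "eval_aut_word n f [x] \<in> iso (free_group n) (free_group n)"
    using f Cons.prems group.iso_set_sym[OF group_free_group, of "f i" n "free_group n"]
    by (auto simp: x eval_aut_word_letter)
  then show ?case using Cons by (subst eval_aut_word_Cons) (auto intro: iso_comp)
qed (auto simp: iso_def hom_def)

lemma eval_aut_word_inv_word:
  assumes f: "\<forall>i<k. f i \<in> iso (free_group n) (free_group n)"
    and w: "\<forall>x\<in>set w. fst x < k" and y: "y \<in> carrier (free_group n)"
  shows "eval_aut_word n f (inv_word w) (eval_aut_word n f w y) = y"
  using w
proof (induction w)
  case (Cons x w)
  obtain i s where x: "x = (i, s)" by force
  let ?z = "eval_aut_word n f w y"
  have z: "?z \<in> carrier (free_group n)"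
    using eval_aut_word_iso[OF f, of w] Cons.prems y by (auto simp: iso_def hom_def)
  have "bij_betw (f i) (carrier (free_group n)) (carrier (free_group n))"
    using f Cons.prems x by (auto simp: iso_def)
  then have "eval_aut_word n f [(i, \<not> s)] (eval_aut_word n f [(i, s)] ?z) = ?z"
    using z by (cases s)
      (auto simp: eval_aut_word_letter bij_betw_inv_into_left bij_betw_inv_into_right)
  then show ?case using Cons
    by (simp add: inv_word_Cons eval_aut_word_append eval_aut_word_Cons[of n f "(i, s)" w] x)
qed (use y in auto)

definition word_mat :: "nat \<Rightarrow> (nat \<Rightarrow> fword \<Rightarrow> fword) \<Rightarrow> (nat \<times> bool) list \<Rightarrow> int mat" where
  "word_mat n f w = abel_mat n (eval_aut_word n f w)"

lemma word_mat_carrier [simp]: "word_mat n f w \<in> carrier_mat n n"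
  by (simp add: word_mat_def)

lemma word_mat_Nil [simp]: "word_mat n f [] = 1\<^sub>m n"
  by (simp add: word_mat_def abel_mat_id)

lemma iso_imp_hom: "\<phi> \<in> iso G H \<Longrightarrow> \<phi> \<in> hom G H"
  by (simp add: iso_def)

lemma word_mat_append:
  assumes f: "\<forall>i<k. f i \<in> iso (free_group n) (free_group n)"
    and "\<forall>x\<in>set u. fst x < k" "\<forall>x\<in>set v. fst x < k"
  shows "word_mat n f (u @ v) = word_mat n f u * word_mat n f v"
  unfolding word_mat_def eval_aut_word_append
  by (intro abel_mat_comp iso_imp_hom eval_aut_word_iso[OF f] assms)

lemma word_mat_inv_word:
  assumes f: "\<forall>i<k. f i \<in> iso (free_group n) (free_group n)" and w: "\<forall>x\<in>set w. fst x < k"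
  shows "word_mat n f (inv_word w) * word_mat n f w = 1\<^sub>m n"
proof -
  have "word_mat n f (inv_word w) * word_mat n f w = word_mat n f (inv_word w @ w)"
    by (intro word_mat_append[OF f, symmetric]) (use w in \<open>auto simp: fst_inv_word_lt\<close>)
  also have "\<dots> = abel_mat n id"
    unfolding word_mat_def
    by (rule abel_mat_cong) (simp add: eval_aut_word_append eval_aut_word_inv_word[OF f w])
  finally show ?thesis by (simp add: abel_mat_id)
qed

section \<open>Free factors and invariant summands\<close>

lemma mat_eq_cols:
  assumes "A \<in> carrier_mat n m" "B \<in> carrier_mat n m" "\<And>j. j < m \<Longrightarrow> col A j = col B j"
  shows "A = B"
  using assms by (intro eq_matI) (auto simp flip: index_col)

text \<open>On \<open>L\<close>, multiplication by \<open>W\<close> reads off coordinates with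
  respect to the columns of \<open>C\<close>. The equality \<open>N L = L\<close>, rather than an
  inclusion, supplies preimages of these columns in \<open>L\<close>; their coordinates form the
  inverse \<open>R\<close> of \<open>Q\<close>.\<close>

lemma preserves_summandI:
  assumes C: "C \<in> carrier_mat n r" and W: "W \<in> carrier_mat r n" and WC: "W * C = 1\<^sub>m r"
    and N: "N \<in> carrier_mat n n"
    and L: "\<And>v. v \<in> L \<Longrightarrow> v \<in> carrier_vec n" "\<And>v. v \<in> L \<Longrightarrow> C *\<^sub>v (W *\<^sub>v v) = v"
    and cols: "\<And>j. j < r \<Longrightarrow> col C j \<in> L"
    and NL: "(\<lambda>v. N *\<^sub>v v) ` L = L"
  shows "preserves_summand n r N"
proof -
  define Q where "Q = W * (N * C)"
  have "\<exists>v. v \<in> L \<and> N *\<^sub>v v = col C j" if "j < r" for j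
    using cols[OF that] NL by (metis imageE)
  then obtain V where V: "\<And>j. j < r \<Longrightarrow> V j \<in> L \<and> N *\<^sub>v V j = col C j" by metis
  define Vm where "Vm = mat n r (\<lambda>(i, j). V j $ i)"
  have Vm: "Vm \<in> carrier_mat n r" by (simp add: Vm_def)
  have colV: "col Vm j = V j" if "j < r" for j
    using V[OF that] L(1)[of "V j"] that by (intro eq_vecI) (auto simp: Vm_def)
  define R where "R = W * Vm"
  have Q: "Q \<in> carrier_mat r r" and R: "R \<in> carrier_mat r r"
    using C W N Vm by (auto simp: Q_def R_def)
  have NC: "N * C \<in> carrier_mat n r" using N C by simp
  have 1: "C * Q = N * C"
  proof (rule mat_eq_cols[of _ n r])
    fix j assume j: "j < r"
    have cNC: "col (N * C) j = N *\<^sub>v col C j" using N C j by (simp add: col_mult2)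
    have "col (C * Q) j = C *\<^sub>v (W *\<^sub>v col (N * C) j)"
      using C W NC j Q col_mult2[OF C Q j] col_mult2[OF W NC j] by (simp add: Q_def)
    also have "\<dots> = col (N * C) j"
      unfolding cNC by (rule L(2)) (use cols[OF j] NL in blast)
    finally show "col (C * Q) j = col (N * C) j" .
  qed (use C Q NC in auto)
  have 2: "C * R = Vm"
  proof (rule mat_eq_cols[of _ n r])
    fix j assume j: "j < r"
    have "col (C * R) j = C *\<^sub>v (W *\<^sub>v col Vm j)"
      using col_mult2[OF C R j] col_mult2[OF W Vm j] by (simp add: R_def)
    then show "col (C * R) j = col Vm j"
      using L(2)[of "V j"] V[OF j] colV[OF j] by simp
  qed (use C R Vm in auto)
  have 3: "N * Vm = C"
  proof (rule mat_eq_cols[of _ n r])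
    fix j assume j: "j < r"
    show "col (N * Vm) j = col C j" using col_mult2[OF N Vm j] V[OF j] colV[OF j] by simp
  qed (use C N Vm in auto)
  have "Q * R = W * (N * (C * R))"
    using W N C R NC unfolding Q_def
    by (simp add: assoc_mult_mat[of W r n "N * C" r R r] assoc_mult_mat[of N n n C r R r])
  then have 4: "Q * R = 1\<^sub>m r" using 2 3 WC by simp
  show ?thesis unfolding preserves_summand_def
    by (rule exI[of _ C], rule exI[of _ W], rule exI[of _ Q], rule exI[of _ R])
       (use C W Q R WC 1 4 in auto)
qed

lemma free_basis_subst:
  "free_basis n b \<longleftrightarrow> (\<forall>i<n. b i \<in> carrier (free_group n)) \<and>
     bij_betw (\<lambda>w. reduce (subst b w)) (carrier (free_group n)) (carrier (free_group n))"
  by (simp add: free_basis_def subst_def)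

text \<open>Turns \<open>H \<noteq> carrier (free_group n)\<close> into
  \<open>S \<noteq> {..<n}\<close>, so that the rank of the summand is less than
  \<open>n\<close>.\<close>

lemma generate_free_basis:
  assumes "free_basis n b"
  shows "generate (free_group n) (b ` {..<n}) = carrier (free_group n)"
proof
  interpret group "free_group n" by (rule group_free_group)
  show "generate (free_group n) (b ` {..<n}) \<subseteq> carrier (free_group n)"
    using assms by (intro generate_incl) (auto simp: free_basis_subst)
  have *: "reduce (subst b w) \<in> generate (free_group n) (b ` {..<n})" if "\<forall>x\<in>set w. fst x < n" for w
    using that
  proof (induction w)
    case Nil
    then show ?case using generate.one[of "free_group n"] by simp
  next
    case (Cons x w)
    obtain i s where x: "x = (i, s)" by force
    have i: "i < n" using Cons.prems x by simp
    have bi: "b i \<in> carrier (free_group n)" using assms i by (simp add: free_basis_subst)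
    have "reduce (b i) \<in> generate (free_group n) (b ` {..<n})"
      using i bi generate.incl[of "b i" "b ` {..<n}" "free_group n"]
      by (simp add: carrier_free_group reduce_reduced)
    moreover have "reduce (inv_word (b i)) \<in> generate (free_group n) (b ` {..<n})"
      using i inv_free_group[OF bi] generate.inv[of "b i" "b ` {..<n}" "free_group n"] by simp
    ultimately have "reduce (subst b [x]) \<in> generate (free_group n) (b ` {..<n})"
      by (simp add: x)
    then show ?case
      using generate.eng[of _ "free_group n" _ "reduce (subst b w)"] Cons
      by (subst subst_Cons) fastforce
  qed
  show "carrier (free_group n) \<subseteq> generate (free_group n) (b ` {..<n})"
  proof
    fix y assume "y \<in> carrier (free_group n)"
    then obtain w where "w \<in> carrier (free_group n)" "y = reduce (subst b w)"
      using assms by (auto simp: free_basis_subst bij_betw_def)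
    then show "y \<in> generate (free_group n) (b ` {..<n})" using * by (auto simp: carrier_free_group)
  qed
qed

lemma expo_inv:
  "g \<in> carrier (free_group n) \<Longrightarrow> expo i (inv\<^bsub>free_group n\<^esub> g) = - expo i g"
  by (simp add: inv_free_group)

text \<open>Conjugation is invisible after abelianising.\<close>

lemma abel_conj_subgroups:
  assumes "conj_subgroups (free_group n) (\<phi> ` H) H'" "\<phi> \<in> hom (free_group n) (free_group n)"
    "H \<subseteq> carrier (free_group n)"
  shows "(\<lambda>v. abel_mat n \<phi> *\<^sub>v v) ` (abel n ` H) = abel n ` H'"
proof -
  obtain g where g: "g \<in> carrier (free_group n)"
    and H': "H' = (\<lambda>h. g \<otimes>\<^bsub>free_group n\<^esub> h \<otimes>\<^bsub>free_group n\<^esub> inv\<^bsub>free_group n\<^esub> g) ` \<phi> ` H"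
    using assms(1) by (auto simp: conj_subgroups_def)
  have "abel n (g \<otimes>\<^bsub>free_group n\<^esub> h \<otimes>\<^bsub>free_group n\<^esub> inv\<^bsub>free_group n\<^esub> g) = abel n h" for h
    using g by (simp add: abel_def expo_inv del: reduce_append_left)
  then have "abel n ` H' = (\<lambda>h. abel n (\<phi> h)) ` H"
    unfolding H' image_image by simp
  also have "\<dots> = (\<lambda>v. abel_mat n \<phi> *\<^sub>v v) ` (abel n ` H)"
    unfolding image_image using abel_hom[OF assms(2)] assms(3) by (intro image_cong) auto
  finally show ?thesis by simp
qed

text \<open>\<open>W\<close> inverts the abelianised base change, so
  \<open>W *\<^sub>v abel n h\<close> lists the coordinates of \<open>h\<close> in the basis
  \<open>b\<close>. They are additive in \<open>h\<close>, so it suffices to look at the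
  generators.\<close>

lemma generate_coord_zero:
  assumes bij: "bij_betw (\<lambda>w. reduce (subst b w)) (carrier (free_group n)) (carrier (free_group n))"
    and b: "\<forall>i<n. b i \<in> carrier (free_group n)" and S: "S \<subseteq> {..<n}"
    and W: "W \<in> carrier_mat n n" "W * abel_mat n (\<lambda>w. reduce (subst b w)) = 1\<^sub>m n"
    and h: "h \<in> generate (free_group n) (b ` S)" and i: "i < n" "i \<notin> S"
  shows "(W *\<^sub>v abel n h) $ i = 0"
proof -
  let ?B = "abel_mat n (\<lambda>w. reduce (subst b w))"
  have Wi: "(W *\<^sub>v abel n h) $ i = (\<Sum>j<n. W $$ (i, j) * expo j h)" for h
    using W i by (simp add: abel_def scalar_prod_def atLeast0LessThan)
  have basis: "(\<Sum>l<n. W $$ (i, l) * expo l (b j)) = 0" if j: "j \<in> S" for j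
  proof -
    have "(\<Sum>l<n. W $$ (i, l) * expo l (b j)) = (W * ?B) $$ (i, j)"
      using W(1) i j S carrier_matD[OF abel_mat_carrier[of n "\<lambda>w. reduce (subst b w)"]]
      by (auto simp: scalar_prod_def abel_mat_def atLeast0LessThan intro!: sum.cong)
    then show ?thesis using W i j S by auto
  qed
  have "(\<Sum>j<n. W $$ (i, j) * expo j h) = 0"
    using h
  proof (induction h rule: generate.induct)
    case (inv h)
    then have "h \<in> carrier (free_group n)" using b S by auto
    then show ?case using inv basis by (auto simp: expo_inv sum_negf)
  next
    case (eng h1 h2)
    then show ?case by (simp add: distrib_left sum.distrib)
  qed (use basis in auto)
  then show ?thesis by (simp add: Wi)
qed

text \<open>The abelianised basis is a matrix \<open>B\<close> with an integral inverse
  \<open>Y\<close>. The columns of \<open>B\<close> indexed by \<open>S\<close> span the image of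
  the factor, and the rows of \<open>Y\<close> indexed by \<open>S\<close> give the
  retraction.\<close>

lemma free_factor_lattice:
  assumes b: "free_basis n b" and S: "S \<subseteq> {..<n}"
  obtains C W where "C \<in> carrier_mat n (card S)" "W \<in> carrier_mat (card S) n" "W * C = 1\<^sub>m (card S)"
    "\<And>v. v \<in> abel n ` generate (free_group n) (b ` S) \<Longrightarrow> C *\<^sub>v (W *\<^sub>v v) = v"
    "\<And>j. j < card S \<Longrightarrow> col C j \<in> abel n ` generate (free_group n) (b ` S)"
proof -
  let ?G = "free_group n" and ?f = "\<lambda>w. reduce (subst b w)"
  define r where "r = card S"
  have bc: "\<forall>i<n. b i \<in> carrier ?G" and bij: "bij_betw ?f (carrier ?G) (carrier ?G)"
    using b by (auto simp: free_basis_subst)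
  have hom: "?f \<in> hom ?G ?G"
    by (rule reduce_subst_hom) (use bc in \<open>auto simp: carrier_free_group\<close>)
  then have iso: "?f \<in> iso ?G ?G" using bij by (simp add: iso_def)
  define g where "g = inv_into (carrier ?G) ?f"
  have g: "g \<in> hom ?G ?G"
    unfolding g_def using group.iso_set_sym[OF group_free_group iso] by (simp add: iso_def)
  define B Y where "B = abel_mat n ?f" and "Y = abel_mat n g"
  have BY: "B \<in> carrier_mat n n" "Y \<in> carrier_mat n n" by (simp_all add: B_def Y_def)
  have YB: "Y * B = 1\<^sub>m n"
    unfolding B_def Y_def abel_mat_comp[OF g hom, symmetric] abel_mat_id[symmetric]
    by (rule abel_mat_cong) (simp add: g_def bij_betw_inv_into_left[OF bij])
  have BYi: "B * Y = 1\<^sub>m n"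
    unfolding B_def Y_def abel_mat_comp[OF hom g, symmetric] abel_mat_id[symmetric]
    by (rule abel_mat_cong) (simp add: g_def bij_betw_inv_into_right[OF bij])
  have fin: "finite S" using S finite_subset by blast
  obtain s where s: "bij_betw s {..<r} S"
    using ex_bij_betw_nat_finite[OF fin] by (auto simp: r_def atLeast0LessThan)
  have sn: "s a < n" "s a \<in> S" if "a < r" for a using s S that by (auto simp: bij_betw_def)
  define C W where "C = mat n r (\<lambda>(i, a). B $$ (i, s a))" and "W = mat r n (\<lambda>(a, i). Y $$ (s a, i))"
  have C: "C \<in> carrier_mat n r" and W: "W \<in> carrier_mat r n" by (simp_all add: C_def W_def)
  have "W * C = 1\<^sub>m r"
  proof (rule eq_matI)
    fix a c assume "a < dim_row (1\<^sub>m r :: int mat)" "c < dim_col (1\<^sub>m r :: int mat)"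
    then have ac: "a < r" "c < r" by auto
    have "(W * C) $$ (a, c) = (Y * B) $$ (s a, s c)"
      using ac sn BY by (simp add: C_def W_def scalar_prod_def)
    also have "\<dots> = 1\<^sub>m r $$ (a, c)"
      using ac sn s by (auto simp: YB bij_betw_def inj_on_def)
    finally show "(W * C) $$ (a, c) = 1\<^sub>m r $$ (a, c)" .
  qed (use C W in auto)
  moreover have "C *\<^sub>v (W *\<^sub>v v) = v" if vL: "v \<in> abel n ` generate ?G (b ` S)" for v
  proof -
    obtain h where h: "h \<in> generate ?G (b ` S)" "v = abel n h" using vL by blast
    have v: "v \<in> carrier_vec n" using h by simp
    have z: "(Y *\<^sub>v v) $ i = 0" if "i < n" "i \<notin> S" for i
      unfolding h(2)
      by (rule generate_coord_zero[OF bij bc S _ _ h(1) that]) (use BY YB in \<open>auto simp: B_def\<close>)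
    have "B *\<^sub>v (Y *\<^sub>v v) = v" using BY v BYi by (metis assoc_mult_mat_vec one_mult_mat_vec)
    moreover have "C *\<^sub>v (W *\<^sub>v v) = B *\<^sub>v (Y *\<^sub>v v)"
    proof (rule eq_vecI)
      fix i assume "i < dim_vec (B *\<^sub>v (Y *\<^sub>v v))"
      then have i: "i < n" using BY by simp
      have "(C *\<^sub>v (W *\<^sub>v v)) $ i = (\<Sum>a<r. B $$ (i, s a) * (Y *\<^sub>v v) $ s a)"
        using i sn C W BY v
        by (auto simp: scalar_prod_def C_def W_def atLeast0LessThan intro!: sum.cong)
      also have "\<dots> = (\<Sum>j\<in>S. B $$ (i, j) * (Y *\<^sub>v v) $ j)"
        by (rule sum.reindex_bij_betw[OF s, where g = "\<lambda>j. B $$ (i, j) * (Y *\<^sub>v v) $ j"])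
      also have "\<dots> = (\<Sum>j<n. B $$ (i, j) * (Y *\<^sub>v v) $ j)"
        by (rule sum.mono_neutral_left) (use S z in auto)
      also have "\<dots> = (B *\<^sub>v (Y *\<^sub>v v)) $ i"
        using i BY v by (simp add: scalar_prod_def atLeast0LessThan)
      finally show "(C *\<^sub>v (W *\<^sub>v v)) $ i = (B *\<^sub>v (Y *\<^sub>v v)) $ i" .
    qed (use C BY in auto)
    ultimately show ?thesis by simp
  qed
  moreover have "col C j \<in> abel n ` generate ?G (b ` S)" if j: "j < r" for j
  proof -
    have "col C j = abel n (b (s j))"
      using sn[OF j] j by (intro eq_vecI) (auto simp: C_def B_def abel_mat_def abel_def)
    then show ?thesis using sn[OF j] by (auto intro: generate.incl)
  qed
  ultimately show thesis using that C W by (simp add: r_def)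
qed

lemma abel_mat_funpow:
  assumes "\<phi> \<in> hom (free_group n) (free_group n)"
  shows "\<phi> ^^ m \<in> hom (free_group n) (free_group n) \<and> abel_mat n (\<phi> ^^ m) = abel_mat n \<phi> ^\<^sub>m m"
proof (induction m)
  case 0
  have "abel_mat n id = 1\<^sub>m n" by (rule abel_mat_id)
  then show ?case by (auto simp: hom_def id_def carrier_matD[OF abel_mat_carrier])
next
  case (Suc m)
  then have "\<phi> ^^ m \<circ> \<phi> \<in> hom (free_group n) (free_group n)" using assms by (auto intro: hom_compose)
  then show ?case using Suc assms abel_mat_comp[of "\<phi> ^^ m" n \<phi>] by (simp add: funpow_Suc_right o_def del: funpow.simps)
qed

text \<open>\<open>g\<close> is only known to map \<open>{..<k}\<close> into itself, so the cycle
  that the orbit of 0 runs into need not contain 0.\<close>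

lemma funpow_cycle:
  fixes g :: "nat \<Rightarrow> nat"
  assumes "\<And>i. i < k \<Longrightarrow> g i < k" "k \<ge> 1"
  obtains i m where "i < k" "m \<ge> 1" "(g ^^ m) i = i"
proof -
  have lt: "(g ^^ t) 0 < k" for t using assms by (induction t) auto
  have "\<not> inj_on (\<lambda>t. (g ^^ t) 0) {..k}"
    by (rule pigeonhole) (use lt card_mono[of "{..<k}" "(\<lambda>t. (g ^^ t) 0) ` {..k}"] in \<open>force simp: less_Suc_eq_le\<close>)
  then obtain a b where ab: "a < b" "(g ^^ a) 0 = (g ^^ b) 0"
    by (auto simp: inj_on_def) (metis linorder_neqE_nat)
  have "(g ^^ (b - a)) ((g ^^ a) 0) = (g ^^ (b - a + a)) 0"
    by (simp only: funpow_add o_apply)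
  also have "\<dots> = (g ^^ a) 0" using ab by simp
  finally show thesis using that[of "(g ^^ a) 0" "b - a"] lt ab by auto
qed

text \<open>Iterating on the level of lattices, where conjugation is invisible, spares the
  composition of conjugators along a cycle of free factors.\<close>

lemma image_mat_pow:
  assumes M: "M \<in> carrier_mat n n" and L: "\<And>i. i < k \<Longrightarrow> L i \<subseteq> carrier_vec n"
    and g: "\<And>i. i < k \<Longrightarrow> g i < k" "\<And>i. i < k \<Longrightarrow> (\<lambda>v. M *\<^sub>v v) ` L i = L (g i)" and i: "i < k"
  shows "(g ^^ m) i < k \<and> (\<lambda>v. (M ^\<^sub>m m) *\<^sub>v v) ` L i = L ((g ^^ m) i)"
  using i
proof (induction m arbitrary: i)
  case 0
  then show ?case using M L by force
next
  case (Suc m)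
  have "(\<lambda>v. (M ^\<^sub>m Suc m) *\<^sub>v v) ` L i = (\<lambda>v. (M ^\<^sub>m m) *\<^sub>v v) ` (\<lambda>v. M *\<^sub>v v) ` L i"
    unfolding image_image
    by (rule image_cong) (use L[OF Suc.prems] M in \<open>auto simp: assoc_mult_mat_vec[of _ n n]\<close>)
  also have "\<dots> = L ((g ^^ Suc m) i)"
    using Suc.IH[OF g(1)[OF Suc.prems]] g(2)[OF Suc.prems] by (simp add: funpow_swap1)
  finally show ?case using Suc.IH[OF g(1)[OF Suc.prems]] by (simp add: funpow_swap1)
qed

lemma preserves_summand_if_lattice:
  assumes b: "free_basis n b" and S: "S \<subseteq> {..<n}" "S \<noteq> {}" "S \<noteq> {..<n}" and N: "N \<in> carrier_mat n n"
    and inv: "(\<lambda>v. N *\<^sub>v v) ` abel n ` generate (free_group n) (b ` S) = abel n ` generate (free_group n) (b ` S)"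
  shows "\<exists>r. 0 < r \<and> r < n \<and> preserves_summand n r N"
proof -
  obtain C W where CW: "C \<in> carrier_mat n (card S)" "W \<in> carrier_mat (card S) n" "W * C = 1\<^sub>m (card S)"
    "\<And>v. v \<in> abel n ` generate (free_group n) (b ` S) \<Longrightarrow> C *\<^sub>v (W *\<^sub>v v) = v"
    "\<And>j. j < card S \<Longrightarrow> col C j \<in> abel n ` generate (free_group n) (b ` S)"
    using free_factor_lattice[OF b S(1)] by metis
  have "preserves_summand n (card S) N"
    by (rule preserves_summandI[OF CW(1-3) N _ CW(4,5) inv]) auto
  moreover have "card S < n" "0 < card S"
    using S psubset_card_mono[of "{..<n}" S] finite_subset[OF S(1)] by (auto simp: card_gt_0_iff)
  ultimately show ?thesis by blast
qed

lemma generate_basis_subset: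
  assumes "free_basis n b" "S \<subseteq> {..<n}"
  shows "generate (free_group n) (b ` S) \<subseteq> carrier (free_group n)"
  using assms by (intro group.generate_incl[OF group_free_group]) (auto simp: free_basis_subst)

lemma not_strongly_irreducible_imp:
  assumes \<phi>: "\<phi> \<in> iso (free_group n) (free_group n)" and "\<not> strongly_irreducible_aut n \<phi>"
  shows "\<exists>m\<ge>1. \<exists>r. 0 < r \<and> r < n \<and> preserves_summand n r (abel_mat n \<phi> ^\<^sub>m m)"
proof -
  obtain m b S H where m: "m \<ge> 1" and b: "free_basis n b" and S: "S \<subseteq> {..<n}"
    and H: "H = generate (free_group n) (b ` S)"
    and ne: "H \<noteq> {[]}" "H \<noteq> carrier (free_group n)"
    and conj: "conj_subgroups (free_group n) ((\<phi> ^^ m) ` H) H"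
    using assms(2) unfolding strongly_irreducible_aut_def not_not free_factor_def one_free_group
    by (elim exE conjE) (rule that; assumption)
  have pow: "\<phi> ^^ m \<in> hom (free_group n) (free_group n)" "abel_mat n (\<phi> ^^ m) = abel_mat n \<phi> ^\<^sub>m m"
    using abel_mat_funpow[OF iso_imp_hom[OF \<phi>]] by blast+
  have S0: "S \<noteq> {}" using ne(1) H group.generate_empty[OF group_free_group, of n] by force
  have S1: "S \<noteq> {..<n}" using ne(2) generate_free_basis[OF b] unfolding H by blast
  have "(\<lambda>v. abel_mat n \<phi> ^\<^sub>m m *\<^sub>v v) ` abel n ` H = abel n ` H"
    using abel_conj_subgroups[OF conj pow(1)] generate_basis_subset[OF b S] unfolding H pow(2) .
  from preserves_summand_if_lattice[OF b S S0 S1 _ this[unfolded H]] show ?thesis using m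
    by (meson abel_mat_carrier pow_carrier_mat)
qed

lemma not_irreducible_imp:
  assumes \<phi>: "\<phi> \<in> iso (free_group n) (free_group n)" and "\<not> irreducible_aut n \<phi>"
  shows "\<exists>m\<ge>1. \<exists>r. 0 < r \<and> r < n \<and> preserves_summand n r (abel_mat n \<phi> ^\<^sub>m m)"
proof -
  let ?H = "\<lambda>b S. generate (free_group n) (b ` S)"
  obtain b k S where b: "free_basis n b" and k: "(k::nat) \<ge> 1"
    and S: "\<forall>i<k. S i \<noteq> {} \<and> S i \<subseteq> {..<n}"
    and disj: "\<forall>i<k. \<forall>j<k. i \<noteq> j \<longrightarrow> S i \<inter> S j = {}"
    and proper: "\<not> (k = 1 \<and> S 0 = {..<n})"
    and ex: "\<forall>i<k. \<exists>j<k. conj_subgroups (free_group n) (\<phi> ` ?H b (S i)) (?H b (S j))"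
    using assms(2) unfolding irreducible_aut_def not_not invariant_proper_ffs_def
    by (elim exE conjE) (rule that; assumption)
  obtain g where g: "\<And>i. i < k \<Longrightarrow> g i < k"
    "\<And>i. i < k \<Longrightarrow> conj_subgroups (free_group n) (\<phi> ` ?H b (S i)) (?H b (S (g i)))"
    using ex by metis
  obtain i m where i: "i < k" and m: "m \<ge> 1" "(g ^^ m) i = i"
    using funpow_cycle[of k g] g(1) k by metis
  have "(\<lambda>v. abel_mat n \<phi> ^\<^sub>m m *\<^sub>v v) ` abel n ` ?H b (S i) = abel n ` ?H b (S ((g ^^ m) i))"
  proof (rule image_mat_pow[where n = n, THEN conjunct2])
    show "(\<lambda>v. abel_mat n \<phi> *\<^sub>v v) ` abel n ` ?H b (S i) = abel n ` ?H b (S (g i))" if "i < k" for i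
      using abel_conj_subgroups[OF g(2)[OF that] iso_imp_hom[OF \<phi>]]
        generate_basis_subset[OF b, of "S i"] S that by auto
  qed (use g i in auto)
  \<comment> \<open>A factor with all indices would leave no room for a second nonempty disjoint
    \<open>S j\<close>; hence \<open>k = 1\<close>, which properness excludes.\<close>
  moreover have "S i \<noteq> {..<n}"
  proof
    assume Si: "S i = {..<n}"
    have "k \<noteq> 1" using proper Si i by auto
    then have "(if i = 0 then 1 else 0) < k" using k by auto
    then obtain j where "j < k" "j \<noteq> i" by (metis zero_neq_one)
    then show False using S disj i Si by blast
  qed
  ultimately have "\<exists>r. 0 < r \<and> r < n \<and> preserves_summand n r (abel_mat n \<phi> ^\<^sub>m m)"
    by (intro preserves_summand_if_lattice[OF b, of "S i"]) (use S i m(2) in \<open>simp_all\<close>)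
  then show ?thesis using m(1) by blast
qed

section \<open>Polynomial functions and products of elementary matrices\<close>

text \<open>Several parameters are treated one at a time, so univariate polynomials with a degree
  bound suffice.\<close>

definition polyfun :: "nat \<Rightarrow> (real \<Rightarrow> real) \<Rightarrow> bool" where
  "polyfun d g \<longleftrightarrow> (\<exists>p. degree p \<le> d \<and> (\<forall>t. g t = poly p t))"

lemma polyfunI: "degree p \<le> d \<Longrightarrow> (\<And>t. g t = poly p t) \<Longrightarrow> polyfun d g"
  by (auto simp: polyfun_def)

lemma polyfun_const: "polyfun d (\<lambda>t. c)"
  by (rule polyfunI[of "[:c:]"]) auto

lemma polyfun_linear: "polyfun 1 (\<lambda>t. t)"
  by (rule polyfunI[of "[:0, 1:]"]) auto

lemma polyfun_add: "polyfun d g \<Longrightarrow> polyfun d h \<Longrightarrow> polyfun d (\<lambda>t. g t + h t)"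
  unfolding polyfun_def by (metis degree_add_le poly_add)

lemma polyfun_diff: "polyfun d g \<Longrightarrow> polyfun d h \<Longrightarrow> polyfun d (\<lambda>t. g t - h t)"
  unfolding polyfun_def by (metis degree_diff_le poly_diff)

lemma polyfun_mult: "polyfun d g \<Longrightarrow> polyfun d' h \<Longrightarrow> polyfun (d + d') (\<lambda>t. g t * h t)"
  unfolding polyfun_def by (metis (no_types, lifting) add_mono degree_mult_le order_trans poly_mult)

lemma polyfun_sum: "(\<And>i. i \<in> A \<Longrightarrow> polyfun d (g i)) \<Longrightarrow> polyfun d (\<lambda>t. \<Sum>i\<in>A. g i t)"
  by (induction A rule: infinite_finite_induct) (auto intro: polyfun_const polyfun_add)

lemma polyfun_prod: "(\<And>i. i \<in> A \<Longrightarrow> polyfun (d i) (g i)) \<Longrightarrow> polyfun (sum d A) (\<lambda>t. \<Prod>i\<in>A. g i t)"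
  by (induction A rule: infinite_finite_induct) (auto intro: polyfun_const polyfun_mult)

lemma polyfun_card_roots:
  assumes "polyfun d g" "g a \<noteq> 0" "finite S"
  shows "card {t \<in> S. g t = 0} \<le> d"
proof -
  obtain p where p: "degree p \<le> d" "\<And>t. g t = poly p t" using assms(1) by (auto simp: polyfun_def)
  have "p \<noteq> 0" using assms(2) p(2) by auto
  then have "card {t \<in> S. g t = 0} \<le> card {t. poly p t = 0}"
    by (intro card_mono) (auto simp: p(2) poly_roots_finite)
  also have "\<dots> \<le> degree p" using \<open>p \<noteq> 0\<close> by (rule card_poly_roots_bound)
  finally show ?thesis using p(1) by simp
qed

definition polymat :: "nat \<Rightarrow> nat \<Rightarrow> (real \<Rightarrow> real mat) \<Rightarrow> bool" where
  "polymat d n F \<longleftrightarrow> (\<forall>t. F t \<in> carrier_mat n n) \<and> (\<forall>i<n. \<forall>j<n. polyfun d (\<lambda>t. F t $$ (i, j)))"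

lemma polymat_const: "A \<in> carrier_mat n n \<Longrightarrow> polymat d n (\<lambda>t. A)"
  by (auto simp: polymat_def intro: polyfun_const)

lemma polymat_mult:
  assumes "polymat d n F" "polymat d' n G"
  shows "polymat (d + d') n (\<lambda>t. F t * G t)"
proof -
  have "(F t * G t) $$ (i, j) = (\<Sum>l<n. F t $$ (i, l) * G t $$ (l, j))" if "i < n" "j < n" for i j t
    using assms that by (auto simp: polymat_def scalar_prod_def atLeast0LessThan
        carrier_matD[of "F t" n n] carrier_matD[of "G t" n n] intro!: sum.cong)
  then show ?thesis using assms
    by (auto simp: polymat_def intro!: polyfun_sum polyfun_mult mult_carrier_mat)
qed

lemma polymat_pow: "polymat d n F \<Longrightarrow> polymat (k * d) n (\<lambda>t. F t ^\<^sub>m k)"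
proof (induction k)
  case 0
  then have "F t ^\<^sub>m 0 = 1\<^sub>m n" for t by (auto simp: polymat_def)
  then show ?case using polymat_const[of "1\<^sub>m n" n 0] by simp
next
  case (Suc k)
  then show ?case using polymat_mult[of "k * d" n "\<lambda>t. F t ^\<^sub>m k" d F] by (simp add: add.commute)
qed

lemma polymat_tensor: "polymat d n F \<Longrightarrow> polymat (r * d) (card (funs r n)) (\<lambda>t. tensor r n (F t))"
  using polyfun_prod[of "{..<r}" "\<lambda>_. d"] enum_funs_lt
  by (auto simp: polymat_def tensor_def)

lemma polyfun_det:
  assumes "polymat d n F"
  shows "polyfun (n * d) (\<lambda>t. det (F t))"
proof -
  have "det (F t) = (\<Sum>p | p permutes {0..<n}. signof p * (\<Prod>i=0..<n. F t $$ (i, p i)))" for t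
    using assms by (intro det_def') (auto simp: polymat_def)
  moreover have "polyfun (0 + (\<Sum>i=0..<n. d)) (\<lambda>t. signof p * (\<Prod>i=0..<n. F t $$ (i, p i)))"
    if "p permutes {0..<n}" for p
    using assms permutes_in_image[OF that]
    by (intro polyfun_mult polyfun_const polyfun_prod) (auto simp: polymat_def)
  ultimately show ?thesis by (auto intro!: polyfun_sum)
qed

text \<open>Matrix entries of degree at most 1 in a parameter acquire the factor \<open>e\<close>
  from the power, \<open>r\<close> from the tensor power and the matrix size from the determinant.
  The factors of the resonance add up.\<close>

definition resonance_degree :: "nat \<Rightarrow> nat \<Rightarrow> nat" where
  "resonance_degree n e = (\<Sum>r = 1..<n. card (funs r n) * (r * (e * 1)))"

lemma polyfun_resonance:
  assumes "polymat 1 n F"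
  shows "polyfun (resonance_degree n e) (\<lambda>t. resonance n e (F t))"
  unfolding resonance_def resonance_degree_def
proof (intro polyfun_prod polyfun_det)
  fix r
  have "polymat (r * (e * 1)) (card (funs r n)) (\<lambda>t. tensor r n (F t ^\<^sub>m e))"
    by (intro polymat_tensor polymat_pow assms)
  then show "polymat (r * (e * 1)) (card (funs r n)) (\<lambda>t. tensor r n (F t ^\<^sub>m e) - 1\<^sub>m (card (funs r n)))"
    unfolding polymat_def
    by (auto simp: carrier_matD[OF tensor_carrier] intro!: polyfun_diff polyfun_const)
qed

definition separately_poly :: "nat \<Rightarrow> nat \<Rightarrow> (real list \<Rightarrow> real) \<Rightarrow> bool" where
  "separately_poly d N f \<longleftrightarrow>
     (\<forall>us vs. Suc (length us + length vs) = N \<longrightarrow> polyfun d (\<lambda>t. f (us @ t # vs)))"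

definition tuples :: "'a set \<Rightarrow> nat \<Rightarrow> 'a list set" where
  "tuples S N = {ts. length ts = N \<and> set ts \<subseteq> S}"

lemma tuples_alt: "tuples S N = {ts. set ts \<subseteq> S \<and> length ts = N}"
  by (auto simp: tuples_def)

lemma finite_tuples: "finite S \<Longrightarrow> finite (tuples S N)"
  unfolding tuples_alt by (rule finite_lists_length_eq)

lemma card_tuples: "finite S \<Longrightarrow> card (tuples S N) = card S ^ N"
  unfolding tuples_alt by (rule card_lists_length_eq)

text \<open>The witness \<open>as\<close> may lie anywhere in real space, not necessarily on the
  grid. The induction freezes the first variable at the value it has in the witness.\<close>

lemma schwartz_zippel:
  assumes "separately_poly d N f" "length as = N" "f as \<noteq> 0" and S: "finite S"
  shows "card {ts \<in> tuples S N. f ts = 0} * card S \<le> N * d * card S ^ N"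
  using assms(1-3)
proof (induction N arbitrary: f as)
  case 0
  then have "{ts \<in> tuples S 0. f ts = 0} = {}" by (auto simp: tuples_def)
  then show ?case by (simp only: card.empty)
next
  case (Suc N)
  obtain a as' where as: "as = a # as'" "length as' = N" using Suc.prems(2) by (cases as) auto
  let ?g = "\<lambda>ts. f (a # ts)"
  have "separately_poly d N ?g"
    unfolding separately_poly_def
  proof (intro allI impI)
    fix us vs :: "real list" assume "Suc (length us + length vs) = N"
    then show "polyfun d (\<lambda>t. f (a # us @ t # vs))"
      using Suc.prems(1)[unfolded separately_poly_def, rule_format, of "a # us" vs] by simp
  qed
  then have IH: "card {ts \<in> tuples S N. ?g ts = 0} * card S \<le> N * d * card S ^ N"
    using Suc.IH[of ?g as'] Suc.prems as by simp
  \<comment> \<open>Tails in \<open>?Z\<close> are rare by induction, and every first entry is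
    charged to them. For a tail in \<open>?Y\<close> the value at \<open>a\<close> is nonzero, so at
    most \<open>d\<close> first entries give a zero.\<close>
  let ?Z = "{ts \<in> tuples S N. ?g ts = 0}" and ?Y = "{ts \<in> tuples S N. ?g ts \<noteq> 0}"
  let ?R = "Sigma ?Y (\<lambda>ts. {t \<in> S. f (t # ts) = 0})"
  have fin: "finite ?Z" "finite ?Y" "finite ?R" using finite_tuples[OF S] S by auto
  have "{ts \<in> tuples S (Suc N). f ts = 0} \<subseteq>
      (\<lambda>(ts, t). t # ts) ` (?Z \<times> S) \<union> (\<lambda>(ts, t). t # ts) ` ?R"
  proof
    fix x assume x: "x \<in> {ts \<in> tuples S (Suc N). f ts = 0}"
    then obtain t ts where "x = t # ts" by (cases x) (auto simp: tuples_def)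
    then show "x \<in> (\<lambda>(ts, t). t # ts) ` (?Z \<times> S) \<union> (\<lambda>(ts, t). t # ts) ` ?R"
      using x by (cases "?g ts = 0") (auto simp: tuples_def image_iff)
  qed
  then have "card {ts \<in> tuples S (Suc N). f ts = 0} \<le>
      card ((\<lambda>(ts, t). t # ts) ` (?Z \<times> S) \<union> (\<lambda>(ts, t). t # ts) ` ?R)"
    using fin S by (intro card_mono) auto
  also have "\<dots> \<le> card ((\<lambda>(ts, t). t # ts) ` (?Z \<times> S)) + card ((\<lambda>(ts, t). t # ts) ` ?R)"
    by (rule card_Un_le)
  also have "\<dots> \<le> card (?Z \<times> S) + card ?R"
    using fin S by (intro add_mono card_image_le) auto
  also have "card ?R = (\<Sum>ts\<in>?Y. card {t \<in> S. f (t # ts) = 0})"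
    using fin S by (intro card_SigmaI) auto
  also have "\<dots> \<le> (\<Sum>ts\<in>?Y. d)"
  proof (rule sum_mono)
    fix ts assume ts: "ts \<in> ?Y"
    then have "polyfun d (\<lambda>t. f ([] @ t # ts))"
      using Suc.prems(1)[unfolded separately_poly_def, rule_format, of "[]" ts] by (simp add: tuples_def)
    then show "card {t \<in> S. f (t # ts) = 0} \<le> d"
      using ts S by (intro polyfun_card_roots[of d "\<lambda>t. f (t # ts)" a]) auto
  qed
  also have "\<dots> \<le> card (tuples S N) * d"
    using finite_tuples[OF S] by (auto intro!: card_mono)
  finally have "card {ts \<in> tuples S (Suc N). f ts = 0} \<le> card ?Z * card S + card S ^ N * d"
    by (simp add: card_cartesian_product card_tuples[OF S])
  then have "card {ts \<in> tuples S (Suc N). f ts = 0} * card S \<le> (card ?Z * card S + card S ^ N * d) * card S"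
    by (rule mult_right_mono) simp
  also have "\<dots> \<le> (N * d * card S ^ N + card S ^ N * d) * card S"
    using IH by (intro mult_right_mono add_mono) auto
  finally show ?case by (simp add: algebra_simps)
qed

section \<open>Gaussian elimination by transvections\<close>

fun transv_prod :: "nat \<Rightarrow> ((nat \<times> nat) \<times> 'a :: comm_ring_1) list \<Rightarrow> 'a mat" where
  "transv_prod n [] = 1\<^sub>m n"
| "transv_prod n (((i, j), t) # xs) = addrow_mat n t i j * transv_prod n xs"

lemma transv_prod_carrier [simp]: "transv_prod n xs \<in> carrier_mat n n"
  by (induction n xs rule: transv_prod.induct) auto

lemma transv_prod_append: "transv_prod n (xs @ ys) = transv_prod n xs * transv_prod n ys"
proof (induction n xs rule: transv_prod.induct)
  case (2 n i j t xs)
  then show ?case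
    by (simp add: assoc_mult_mat[OF addrow_mat_carrier transv_prod_carrier transv_prod_carrier])
qed (simp add: left_mult_one_mat[OF transv_prod_carrier])

definition valid_pairs :: "nat \<Rightarrow> (nat \<times> nat) set" where
  "valid_pairs n = {(i, j). i < n \<and> j < n \<and> i \<noteq> j}"

definition transv_reach :: "nat \<Rightarrow> nat \<Rightarrow> real mat \<Rightarrow> real mat \<Rightarrow> bool" where
  "transv_reach n l A B \<longleftrightarrow>
     (\<exists>xs. length xs \<le> l \<and> fst ` set xs \<subseteq> valid_pairs n \<and> B = A * transv_prod n xs)"

lemma transv_reach_refl: "A \<in> carrier_mat n n \<Longrightarrow> transv_reach n l A A"
  unfolding transv_reach_def by (rule exI[of _ "[]"]) auto

lemma transv_reach_trans:
  assumes "A \<in> carrier_mat n n" "transv_reach n l A B" "transv_reach n l' B C" "l + l' \<le> l''"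
  shows "transv_reach n l'' A C"
proof -
  obtain xs ys where xs: "length xs \<le> l" "fst ` set xs \<subseteq> valid_pairs n" "B = A * transv_prod n xs"
    and ys: "length ys \<le> l'" "fst ` set ys \<subseteq> valid_pairs n" "C = B * transv_prod n ys"
    using assms unfolding transv_reach_def by blast
  have "C = A * transv_prod n (xs @ ys)"
    unfolding ys xs transv_prod_append
    by (rule assoc_mult_mat[OF assms(1) transv_prod_carrier transv_prod_carrier])
  then show ?thesis unfolding transv_reach_def
    by (intro exI[of _ "xs @ ys"]) (use xs ys assms(4) in auto)
qed

lemma transv_reach_carrier: "A \<in> carrier_mat n n \<Longrightarrow> transv_reach n l A B \<Longrightarrow> B \<in> carrier_mat n n"
  by (auto simp: transv_reach_def)

lemma transv_reach_addcol:
  assumes "A \<in> carrier_mat n n" "i < n" "j < n" "i \<noteq> j"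
  shows "transv_reach n 1 A (addcol t j i A)"
  unfolding transv_reach_def
  by (rule exI[of _ "[((i, j), t)]"]) (use assms addcol_mat[OF assms(1,2)] in \<open>auto simp: valid_pairs_def\<close>)

definition unit_rows :: "nat \<Rightarrow> nat \<Rightarrow> real mat \<Rightarrow> bool" where
  "unit_rows n k A \<longleftrightarrow> (\<forall>i<k. \<forall>j<n. A $$ (i, j) = (if i = j then 1 else 0))"

text \<open>Column \<open>k\<close> holds the pivot and is never altered, so the entries after each
  operation remain explicit in those of \<open>A\<close>. The turn \<open>L = k\<close> does
  nothing.\<close>

lemma clear_row:
  assumes A: "A \<in> carrier_mat n n" and k: "k < n" and A1: "A $$ (k, k) = 1" and L: "L \<le> n"
  shows "\<exists>B. transv_reach n L A B \<and> (\<forall>i<n. \<forall>l<n. B $$ (i, l) =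
    (if l < L \<and> l \<noteq> k then A $$ (i, l) - A $$ (k, l) * A $$ (i, k) else A $$ (i, l)))"
  using L
proof (induction L)
  case 0
  show ?case by (rule exI[of _ A]) (use A transv_reach_refl in auto)
next
  case (Suc L)
  then obtain B where B: "transv_reach n L A B" and Be: "\<And>i l. i < n \<Longrightarrow> l < n \<Longrightarrow> B $$ (i, l) =
    (if l < L \<and> l \<noteq> k then A $$ (i, l) - A $$ (k, l) * A $$ (i, k) else A $$ (i, l))"
    by auto
  have Bc: "B \<in> carrier_mat n n" using transv_reach_carrier[OF A B] .
  show ?case
  proof (cases "L = k")
    case True
    show ?thesis
      by (rule exI[of _ B])
         (use transv_reach_trans[OF A B transv_reach_refl[OF Bc, of 0], of "Suc L"] Be True in auto)
  next
    case False
    let ?C = "addcol (- A $$ (k, L)) L k B"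
    have "transv_reach n (Suc L) A ?C"
      by (rule transv_reach_trans[OF A B transv_reach_addcol[OF Bc k]]) (use Suc False in auto)
    moreover have "?C $$ (i, l) =
      (if l < Suc L \<and> l \<noteq> k then A $$ (i, l) - A $$ (k, l) * A $$ (i, k) else A $$ (i, l))"
      if "i < n" "l < n" for i l
      using that Be[OF that] Be[OF that(1) k] Bc False by (auto simp: mat_addcol_def less_Suc_eq)
    ultimately show ?thesis by blast
  qed
qed

text \<open>Earlier rows survive the clearing because \<open>A $$ (i, k)\<close> is 0 for
  \<open>i < k\<close>.\<close>

lemma unit_rows_Suc:
  assumes A: "A \<in> carrier_mat n n" and k: "k < n" and A1: "A $$ (k, k) = 1" and u: "unit_rows n k A"
  shows "\<exists>B. transv_reach n n A B \<and> unit_rows n (Suc k) B"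
proof -
  obtain B where B: "transv_reach n n A B" and Be: "\<And>i l. i < n \<Longrightarrow> l < n \<Longrightarrow> B $$ (i, l) =
    (if l < n \<and> l \<noteq> k then A $$ (i, l) - A $$ (k, l) * A $$ (i, k) else A $$ (i, l))"
    using clear_row[OF A k A1 order_refl] by auto
  have "unit_rows n (Suc k) B"
    unfolding unit_rows_def using Be u A1 k by (auto simp: unit_rows_def less_Suc_eq)
  then show ?thesis using B by blast
qed

text \<open>The unit rows of \<open>A\<close> force \<open>A' $$ (i, k) = 0\<close> for
  \<open>i < k\<close>. If row \<open>k\<close> of \<open>A\<close> vanished from column
  \<open>k\<close> on, the diagonal entry of \<open>A * A'\<close> in row \<open>k\<close> would be
  0.\<close>

lemma nonzero_in_row:
  assumes A: "A \<in> carrier_mat n n" "A' \<in> carrier_mat n n" "A * A' = 1\<^sub>m n" and k: "k < n"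
    and u: "unit_rows n k A"
  shows "\<exists>j\<ge>k. j < n \<and> A $$ (k, j) \<noteq> 0"
proof (rule ccontr)
  assume no: "\<not> ?thesis"
  have e: "(\<Sum>l<n. A $$ (i, l) * A' $$ (l, k)) = (if i = k then 1 else 0)" if "i < n" for i
    using arg_cong[OF A(3), of "\<lambda>M. M $$ (i, k)"] A(1,2) k that
    by (simp add: scalar_prod_def atLeast0LessThan)
  have "A' $$ (i, k) = 0" if i: "i < k" for i
  proof -
    have "(\<Sum>l<n. A $$ (i, l) * A' $$ (l, k)) = (\<Sum>l<n. if l = i then A' $$ (i, k) else 0)"
      using u i k by (intro sum.cong) (auto simp: unit_rows_def)
    then show ?thesis using e[of i] i k by simp
  qed
  then have "(\<Sum>l<n. A $$ (k, l) * A' $$ (l, k)) = 0"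
    using no by (intro sum.neutral) (metis lessThan_iff mult_zero_left mult_zero_right not_le)
  then show False using e[OF k] by simp
qed

lemma det_transv_reach:
  assumes A: "A \<in> carrier_mat n n" and d: "det A = 1" and B: "transv_reach n l A B"
  shows "det B = 1"
proof -
  have "det (transv_prod n xs :: real mat) = 1" if "fst ` set xs \<subseteq> valid_pairs n" for xs
    using that
    by (induction n xs rule: transv_prod.induct)
       (auto simp: valid_pairs_def det_mult[OF addrow_mat_carrier transv_prod_carrier] det_addrow_mat)
  then show ?thesis using B A d by (auto simp: transv_reach_def det_mult[OF A transv_prod_carrier])
qed

lemma one_smult_mat: "(1 :: 'a :: semiring_1) \<cdot>\<^sub>m A = A"
  by (rule eq_matI) auto

text \<open>Transvections cannot scale a column, so the pivot is made 1 by adding a multiple of a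
  column further right with nonzero entry in row \<open>k\<close>. If there is none, column
  \<open>k\<close> is first added to column \<open>k + 1\<close>. These two operations and the
  clearing of the row account for \<open>n + 2\<close>.\<close>

lemma gauss_step:
  assumes A: "A \<in> carrier_mat n n" and d: "det A = 1" and k: "Suc k < n" and u: "unit_rows n k A"
  shows "\<exists>B. transv_reach n (n + 2) A B \<and> unit_rows n (Suc k) B"
proof -
  have "A * adj_mat A = 1\<^sub>m n" using adj_mat(2)[OF A] d by (simp add: one_smult_mat)
  then obtain j where j: "j \<ge> k" "j < n" "A $$ (k, j) \<noteq> 0"
    using nonzero_in_row[OF A adj_mat(1)[OF A] _ _ u] k by auto
  have "\<exists>B j. transv_reach n 1 A B \<and> unit_rows n k B \<and> j > k \<and> j < n \<and> B $$ (k, j) \<noteq> 0"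
  proof (cases "\<exists>j>k. j < n \<and> A $$ (k, j) \<noteq> 0")
    case True
    then show ?thesis using transv_reach_refl[OF A, of 1] u by blast
  next
    case False
    then have jk: "j = k" using j by (metis le_neq_implies_less)
    let ?B = "addcol 1 (Suc k) k A"
    have "transv_reach n 1 A ?B" using transv_reach_addcol[OF A] k by simp
    moreover have "unit_rows n k ?B" using u A k by (auto simp: unit_rows_def mat_addcol_def)
    moreover have "?B $$ (k, Suc k) \<noteq> 0"
      using False j jk A k by (auto simp: mat_addcol_def)
    ultimately show ?thesis using k by blast
  qed
  then obtain B j where B: "transv_reach n 1 A B" "unit_rows n k B" and j: "j > k" "j < n" "B $$ (k, j) \<noteq> 0"
    by blast
  have Bc: "B \<in> carrier_mat n n" using transv_reach_carrier[OF A B(1)] .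
  let ?C = "addcol ((1 - B $$ (k, k)) / B $$ (k, j)) k j B"
  have C: "transv_reach n 1 B ?C" using transv_reach_addcol[OF Bc] k j by simp
  have AC: "transv_reach n 2 A ?C" by (rule transv_reach_trans[OF A B(1) C]) simp
  have Cc: "?C \<in> carrier_mat n n" using transv_reach_carrier[OF A AC] .
  have "?C $$ (k, k) = 1" using Bc k j by (simp add: mat_addcol_def)
  moreover have "unit_rows n k ?C" using B(2) Bc k j by (auto simp: unit_rows_def mat_addcol_def)
  ultimately have "\<exists>E. transv_reach n n ?C E \<and> unit_rows n (Suc k) E"
    by (intro unit_rows_Suc[OF Cc]) (use k in auto)
  then obtain E where "transv_reach n n ?C E" "unit_rows n (Suc k) E" by blast
  then show ?thesis using transv_reach_trans[OF A AC, of n E "n + 2"] by auto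
qed

lemma gauss:
  assumes A: "A \<in> carrier_mat n n" and d: "det A = 1" and n: "n > 0"
  shows "transv_reach n (n * (n + 2)) A (1\<^sub>m n)"
proof -
  have "\<exists>B. transv_reach n (k * (n + 2)) A B \<and> unit_rows n k B" if "k < n" for k
    using that
  proof (induction k)
    case 0
    show ?case using transv_reach_refl[OF A] by (auto simp: unit_rows_def)
  next
    case (Suc k)
    then obtain B where B: "transv_reach n (k * (n + 2)) A B" "unit_rows n k B" by auto
    have Bc: "B \<in> carrier_mat n n" using transv_reach_carrier[OF A B(1)] .
    obtain E where "transv_reach n (n + 2) B E" "unit_rows n (Suc k) E"
      using gauss_step[OF Bc det_transv_reach[OF A d B(1)] Suc.prems B(2)] by blast
    then show ?case using transv_reach_trans[OF A B(1), of "n + 2" E "Suc k * (n + 2)"] by auto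
  qed
  from this[of "n - 1"] obtain B where B: "transv_reach n ((n - 1) * (n + 2)) A B" and u: "unit_rows n (n - 1) B"
    using n by auto
  have Bc: "B \<in> carrier_mat n n" using transv_reach_carrier[OF A B] .
  \<comment> \<open>The last diagonal entry has no column to its right, but \<open>B\<close> is
    lower triangular with all other diagonal entries 1, so the determinant forces it to be
    1.\<close>
  have "det B = prod_list (diag_mat B)"
    by (rule det_lower_triangular[OF _ Bc]) (use u in \<open>auto simp: unit_rows_def\<close>)
  also have "\<dots> = (\<Prod>i<n. B $$ (i, i))" using Bc by (simp add: prod_list_diag_prod atLeast0LessThan)
  also have "\<dots> = (\<Prod>i<n. if i = n - 1 then B $$ (n - 1, n - 1) else 1)"
    using u by (intro prod.cong) (auto simp: unit_rows_def)
  also have "\<dots> = B $$ (n - 1, n - 1)" using n by simp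
  finally have "B $$ (n - 1, n - 1) = 1" using det_transv_reach[OF A d B] by simp
  then obtain E where E: "transv_reach n n B E" "unit_rows n n E"
    using unit_rows_Suc[OF Bc _ _ u] n by auto
  have "E = 1\<^sub>m n"
    using transv_reach_carrier[OF Bc E(1)] E(2) by (intro eq_matI) (auto simp: unit_rows_def)
  moreover have "(n - 1) * (n + 2) + n \<le> n * (n + 2)" using n by (cases n) auto
  ultimately show ?thesis using transv_reach_trans[OF A B E(1)] by simp
qed

lemma addrow_mat_0: "addrow_mat n 0 i j = 1\<^sub>m n"
  by (auto simp: addrow_mat_def intro!: eq_matI)

lemma transv_prod_zeros: "transv_prod n (zip ps (replicate (length ps) 0)) = 1\<^sub>m n"
  by (induction ps) (auto simp: addrow_mat_0)

lemma transv_prod_single: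
  assumes "(i, j) \<in> set ps"
  shows "\<exists>ts. length ts = length ps \<and> transv_prod n (zip ps ts) = addrow_mat n t i j"
proof -
  obtain us vs where ps: "ps = us @ (i, j) # vs" using assms split_list by metis
  let ?ts = "replicate (length us) 0 @ t # replicate (length vs) 0"
  have "transv_prod n (zip ps ?ts) = addrow_mat n t i j"
    by (simp add: ps transv_prod_append transv_prod_zeros left_mult_one_mat[OF addrow_mat_carrier]
        right_mult_one_mat[OF addrow_mat_carrier])
  then show ?thesis by (intro exI[of _ ?ts]) (simp add: ps)
qed

lemma transv_prod_universal:
  assumes "length xs \<le> K" "fst ` set xs \<subseteq> set ps"
  shows "\<exists>ts. length ts = length (concat (replicate K ps)) \<and>
    transv_prod n (zip (concat (replicate K ps)) ts) = transv_prod n xs"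
  using assms
proof (induction K arbitrary: xs)
  case (Suc K)
  have zip: "transv_prod n (zip (ps @ qs) (ts @ us)) = transv_prod n (zip ps ts) * transv_prod n (zip qs us)"
    if "length ts = length ps" for qs and ts us :: "'a list"
    using that by (simp add: transv_prod_append)
  show ?case
  proof (cases xs)
    case Nil
    then show ?thesis
      by (intro exI[of _ "replicate (length (concat (replicate (Suc K) ps))) 0"])
         (simp add: transv_prod_zeros del: replicate_Suc)
  next
    case (Cons x ys)
    obtain i j t where x: "x = ((i, j), t)" by (metis surj_pair)
    have "length ys \<le> K" "fst ` set ys \<subseteq> set ps" "(i, j) \<in> set ps" using Suc.prems Cons x by auto
    then obtain us ts where "length us = length (concat (replicate K ps))"
      "transv_prod n (zip (concat (replicate K ps)) us) = transv_prod n ys"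
      "length ts = length ps" "transv_prod n (zip ps ts) = addrow_mat n t i j"
      using Suc.IH transv_prod_single by metis
    then show ?thesis
      by (intro exI[of _ "ts @ us"]) (simp add: zip Cons x del: zip_append)
  qed
qed auto

text \<open>One pattern has to serve all matrices of determinant 1, so that a single function of
  \<open>length ps\<close> real parameters reaches the whole group.\<close>

definition universal :: "nat \<Rightarrow> (nat \<times> nat) list \<Rightarrow> bool" where
  "universal n ps \<longleftrightarrow> (\<forall>B \<in> carrier_mat n n. det B = (1 :: real) \<longrightarrow>
     (\<exists>ts. length ts = length ps \<and> transv_prod n (zip ps ts) = B))"

lemma universal_pattern:
  assumes n: "n > 0"
  obtains ps where "set ps \<subseteq> valid_pairs n"
    "universal n ps"
proof -
  have "finite (valid_pairs n)"
    by (rule finite_subset[of _ "{..<n} \<times> {..<n}"]) (auto simp: valid_pairs_def)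
  then obtain qs where qs: "set qs = valid_pairs n" using finite_list by blast
  define ps where "ps = concat (replicate (n * (n + 2)) qs)"
  show thesis
  proof (rule that[of ps])
    show "set ps \<subseteq> valid_pairs n" using qs by (auto simp: ps_def)
    have "\<exists>ts. length ts = length ps \<and> transv_prod n (zip ps ts) = B"
      if B: "B \<in> carrier_mat n n" "det B = 1" for B :: "real mat"
    proof -
      \<comment> \<open>Since the determinant is 1, the adjugate is the inverse. Column operations
        that reduce the inverse to the identity multiply up to \<open>B\<close> itself.\<close>
      let ?A = "adj_mat B"
      have A: "?A \<in> carrier_mat n n" "B * ?A = 1\<^sub>m n" "?A * B = 1\<^sub>m n" using adj_mat[OF B(1)] B(2) by (simp_all add: one_smult_mat)
      have "det ?A = 1" using det_mult[OF B(1) A(1)] A(2) B(2) by simp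
      then obtain xs where xs: "length xs \<le> n * (n + 2)" "fst ` set xs \<subseteq> valid_pairs n" "1\<^sub>m n = ?A * transv_prod n xs"
        using gauss[OF A(1) _ n] unfolding transv_reach_def by blast
      have "B = B * (?A * transv_prod n xs)" unfolding xs(3)[symmetric] using B by simp
      also have "\<dots> = transv_prod n xs"
        using A B assoc_mult_mat[OF B(1) A(1) transv_prod_carrier, of xs]
        by (simp add: left_mult_one_mat[OF transv_prod_carrier])
      finally show ?thesis
        using transv_prod_universal[OF xs(1), of qs n] xs(2) qs by (simp add: ps_def)
    qed
    then show "universal n ps" by (simp add: universal_def)
  qed
qed

lemma separately_poly_resonance:
  assumes A: "A \<in> carrier_mat n n" and B: "B \<in> carrier_mat n n"
  shows "separately_poly (resonance_degree n e) (length ps) (\<lambda>ts. resonance n e (A * transv_prod n (zip ps ts) * B))"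
  unfolding separately_poly_def
proof (intro allI impI)
  fix us vs :: "real list" assume len: "Suc (length us + length vs) = length ps"
  define p1 where "p1 = take (length us) ps"
  define p2 where "p2 = drop (Suc (length us)) ps"
  obtain i j where ij: "ps ! length us = (i, j)" by force
  have ps: "ps = p1 @ (i, j) # p2" unfolding p1_def p2_def
    using len id_take_nth_drop[of "length us" ps] ij by simp
  have l1: "length p1 = length us" using len by (simp add: p1_def)
  have U: "transv_prod n (zip ps (us @ t # vs)) =
      transv_prod n (zip p1 us) * (addrow_mat n t i j * transv_prod n (zip p2 vs))" for t
    by (simp add: ps l1 transv_prod_append)
  have "polyfun 1 (\<lambda>t. addrow_mat n t i j $$ (a, b))" if "a < n" "b < n" for a b
    using that polyfun_add[OF polyfun_linear polyfun_const[of 1 "if a = b then 1 else 0"]]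
      polyfun_const[of 1 "if a = b then 1 else 0"]
    by (cases "i = a \<and> j = b") (auto simp: addrow_mat_def)
  then have "polymat 1 n (\<lambda>t. addrow_mat n t i j)" by (auto simp: polymat_def)
  \<comment> \<open>The summands are the degrees in \<open>t\<close> of \<open>A\<close>, the left
    part of the pattern, the elementary matrix containing \<open>t\<close>, the right part, and
    \<open>B\<close>.\<close>
  then have "polymat (0 + (0 + (1 + 0)) + 0) n (\<lambda>t. A * transv_prod n (zip ps (us @ t # vs)) * B)"
    unfolding U by (intro polymat_mult polymat_const A B transv_prod_carrier)
  then show "polyfun (resonance_degree n e) (\<lambda>t. resonance n e (A * transv_prod n (zip ps (us @ t # vs)) * B))"
    by (intro polyfun_resonance) simp
qed

section \<open>A point where the resonance does not vanish\<close>

lemma mat_diag_pow: "mat_diag n f ^\<^sub>m k = mat_diag n (\<lambda>i. f i ^ k)"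
  by (induction k) (auto simp: carrier_matD[OF mat_diag_dim] power_commutes)

lemma tensor_mat_diag: "tensor r n (mat_diag n f) = mat_diag (card (funs r n)) (\<lambda>x. \<Prod>i<r. f (enum_funs r n x i))"
proof (rule eq_matI)
  let ?e = "enum_funs r n" and ?D = "card (funs r n)"
  let ?R = "mat_diag ?D (\<lambda>x. \<Prod>i<r. f (?e x i))"
  fix x y assume "x < dim_row ?R" "y < dim_col ?R"
  then have xy: "x < ?D" "y < ?D" by (simp_all add: mat_diag_def)
  have "tensor r n (mat_diag n f) $$ (x, y) = (\<Prod>i<r. if ?e x i = ?e y i then f (?e x i) else 0)"
    using xy enum_funs_lt by (auto simp: tensor_def mat_diag_def intro!: prod.cong)
  also have "\<dots> = ?R $$ (x, y)"
    using enum_funs_eq_iff[OF xy] xy by (auto simp: mat_diag_def intro!: prod_zero)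
  finally show "tensor r n (mat_diag n f) $$ (x, y) = ?R $$ (x, y)" .
qed (simp_all add: tensor_def mat_diag_def)

lemma det_mat_diag: "det (mat_diag n f) = (\<Prod>i<n. f i)"
proof -
  have "det (mat_diag n f) = prod_list (diag_mat (mat_diag n f))"
    by (rule det_lower_triangular[of n]) (auto simp: mat_diag_def)
  then show ?thesis
    by (simp add: prod_list_diag_prod atLeast0LessThan carrier_matD[OF mat_diag_dim]) (simp add: mat_diag_def)
qed

text \<open>In absolute value, a product of \<open>r\<close> diagonal entries is 2 to the power
  \<open>r - n * c\<close>, where \<open>c\<close> counts the occurrences of the last entry. The
  exponent is zero only if \<open>n\<close> divides \<open>r\<close>. Working with absolute values
  leaves the signs free.\<close>

lemma resonance_mat_diag_nonzero:
  fixes d :: "nat \<Rightarrow> real"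
  assumes d: "\<And>i. i < n \<Longrightarrow> \<bar>d i\<bar> = 2 powr (if i = n - 1 then 1 - real n else 1)" and e: "e \<ge> 1"
  shows "resonance n e (mat_diag n d) \<noteq> 0"
proof -
  have nz: "(\<Prod>i<r. d (enum_funs r n x i) ^ e) \<noteq> 1" if r: "0 < r" "r < n" and x: "x < card (funs r n)" for r x
  proof
    let ?a = "enum_funs r n x" and ?w = "\<lambda>i. if i = n - 1 then 1 - real n else 1"
    let ?c = "card {i \<in> {..<r}. ?a i = n - 1}"
    assume "(\<Prod>i<r. d (?a i) ^ e) = 1"
    then have "\<bar>\<Prod>i<r. d (?a i)\<bar> ^ e = 1" by (simp flip: prod_power_distrib power_abs)
    then have "\<bar>\<Prod>i<r. d (?a i)\<bar> = 1" using e power_eq_1_iff[of _ e] by fastforce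
    moreover have "\<bar>\<Prod>i<r. d (?a i)\<bar> = (\<Prod>i<r. 2 powr ?w (?a i))"
      using d enum_funs_lt[OF x] by (simp add: abs_prod)
    ultimately have "2 powr (\<Sum>i<r. ?w (?a i)) = 1" by (simp add: powr_sum)
    then have "(\<Sum>i<r. ?w (?a i)) = 0" by simp
    moreover have "(\<Sum>i<r. ?w (?a i)) = (\<Sum>i<r. 1 - (if ?a i = n - 1 then real n else 0))"
      by (rule sum.cong) auto
    ultimately have "real r = real n * real ?c"
      by (simp add: sum_subtractf sum.If_cases Int_def conj_commute mult.commute)
    then have "r = n * ?c" by (metis of_nat_eq_iff of_nat_mult)
    then obtain c where "r = n * c" by blast
    then show False using r by (cases c) auto
  qed
  have "det (tensor r n (mat_diag n d ^\<^sub>m e) - 1\<^sub>m (card (funs r n))) \<noteq> 0" if r: "r \<in> {1..<n}" for r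
  proof -
    let ?D = "card (funs r n)"
    have "mat_diag ?D g - 1\<^sub>m ?D = mat_diag ?D (\<lambda>x. g x - 1)" for g :: "nat \<Rightarrow> real"
      by (auto simp: mat_diag_def intro!: eq_matI)
    then show ?thesis
      unfolding mat_diag_pow tensor_mat_diag using nz r by (auto simp: det_mat_diag)
  qed
  then show ?thesis by (simp add: resonance_def)
qed

text \<open>The pattern is solved for \<open>A' * D * B'\<close>, so that the whole product becomes
  the diagonal matrix \<open>D\<close>. This needs determinant 1, so the last entry of
  \<open>D\<close> carries the sign \<open>s\<close> of \<open>det A * det B\<close>.\<close>

lemma resonance_nonzero_somewhere:
  assumes n: "n \<ge> 2" and e: "e \<ge> 1"
    and A: "(A :: real mat) \<in> carrier_mat n n" "A' \<in> carrier_mat n n" "A * A' = 1\<^sub>m n" "\<bar>det A\<bar> = 1"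
    and B: "B \<in> carrier_mat n n" "B' \<in> carrier_mat n n" "B' * B = 1\<^sub>m n" "\<bar>det B\<bar> = 1"
    and ps: "universal n ps"
  shows "\<exists>ts. length ts = length ps \<and> resonance n e (A * transv_prod n (zip ps ts) * B) \<noteq> 0"
proof -
  define s where "s = det A * det B"
  define d :: "nat \<Rightarrow> real" where "d i = (if i = n - 1 then s * 2 powr (1 - real n) else 2)" for i
  define D where "D = mat_diag n d"
  have D: "D \<in> carrier_mat n n" by (simp add: D_def)
  have s1: "\<bar>s\<bar> = 1" using A B by (simp add: s_def abs_mult)
  have "res": "resonance n e D \<noteq> 0"
    unfolding D_def by (rule resonance_mat_diag_nonzero[OF _ e]) (auto simp: d_def abs_mult s1)
  have "det D = (\<Prod>i<Suc (n - 1). d i)" using n by (simp add: D_def det_mat_diag)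
  also have "\<dots> = (\<Prod>i<n - 1. 2) * (s * 2 powr (1 - real n))"
    by (subst prod.lessThan_Suc) (auto simp: d_def)
  also have "(\<Prod>i<n - 1. 2) = 2 powr (real n - 1)"
    using n powr_realpow[of 2 "n - 1"] by (simp add: of_nat_diff)
  also have "2 powr (real n - 1) * (s * 2 powr (1 - real n)) = s"
    by (simp flip: powr_add)
  finally have dD: "det D = s" .
  let ?C = "A' * D * B'"
  have "det A * det A' = 1" "det B' * det B = 1"
    using det_mult[OF A(1,2)] A(3) det_mult[OF B(2,1)] B(3) by simp_all
  then have "det A' * (det A * det B * det B') = 1"
    by (metis mult.assoc mult.commute mult_1)
  then have "det ?C = 1"
    using A B D by (simp add: det_mult[of _ n] dD s_def mult.assoc)
  moreover have "?C \<in> carrier_mat n n" using A B D by simp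
  ultimately obtain ts where ts: "length ts = length ps" "transv_prod n (zip ps ts) = ?C"
    using ps unfolding universal_def by blast
  have "A * ?C * B = (A * A') * D * (B' * B)"
    using A(1,2) B(1,2) D by (simp add: assoc_mult_mat[of _ n n _ n _ n])
  also have "\<dots> = D" using A B D by simp
  finally show ?thesis using ts "res" by auto
qed

section \<open>Counting words\<close>

lemma card_tuples_split:
  assumes "finite S"
  shows "card {x \<in> tuples S (a + b). P x} = (\<Sum>y\<in>tuples S a. card {z \<in> tuples S b. P (y @ z)})"
proof -
  have "bij_betw (\<lambda>(y, z). y @ z) (SIGMA y:tuples S a. {z \<in> tuples S b. P (y @ z)}) {x \<in> tuples S (a + b). P x}"
    by (rule bij_betw_byWitness[where f' = "\<lambda>x. (take a x, drop a x)"])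
       (auto simp: tuples_def dest: in_set_takeD in_set_dropD)
  then have "card {x \<in> tuples S (a + b). P x} = card (SIGMA y:tuples S a. {z \<in> tuples S b. P (y @ z)})"
    by (simp add: bij_betw_same_card)
  also have "\<dots> = (\<Sum>y\<in>tuples S a. card {z \<in> tuples S b. P (y @ z)})"
    using finite_tuples[OF assms] by (intro card_SigmaI) auto
  finally show ?thesis .
qed

lemma sum_card_swap:
  assumes "finite A" "finite B"
  shows "(\<Sum>y\<in>A. card {z \<in> B. R y z}) = (\<Sum>z\<in>B. card {y \<in> A. R y z})"
proof -
  have "(\<Sum>y\<in>A. card {z \<in> B. R y z}) = (\<Sum>y\<in>A. \<Sum>z\<in>B. if R y z then 1 else 0)"
    using assms by (intro sum.cong refl) (simp add: sum.If_cases Int_def)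
  also have "\<dots> = (\<Sum>z\<in>B. \<Sum>y\<in>A. if R y z then 1 else 0)" by (rule sum.swap)
  also have "\<dots> = (\<Sum>z\<in>B. card {y \<in> A. R y z})"
    using assms by (intro sum.cong refl) (simp add: sum.If_cases Int_def)
  finally show ?thesis .
qed

text \<open>Condition on the first of \<open>J\<close> consecutive blocks that lies in \<open>\<B>\<close>, and on everything outside it:
  what is left is uniformly distributed on \<open>\<B>\<close>. With probability \<open>\<rho> ^ J\<close> there is no such block.\<close>

lemma card_bad_blocks:
  fixes \<epsilon> :: real
  assumes S: "finite S" "S \<noteq> {}" and \<B>: "\<B> \<subseteq> tuples S l" and \<epsilon>: "\<epsilon> \<ge> 0"
    and bad: "\<And>u v. set u \<subseteq> S \<Longrightarrow> set v \<subseteq> S \<Longrightarrow> real (card {b \<in> \<B>. P (u @ b @ v)}) \<le> \<epsilon> * real (card \<B>)"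
    and \<rho>: "\<rho> = 1 - real (card \<B>) / real (card S ^ l)"
    and u: "set u \<subseteq> S" and v: "set v \<subseteq> S"
  shows "real (card {x \<in> tuples S (l * J). P (u @ x @ v)}) \<le> (\<epsilon> + \<rho> ^ J) * real (card S ^ (l * J))"
  using u
proof (induction J arbitrary: u)
  case 0
  have "card {x \<in> tuples S (l * 0). P (u @ x @ v)} \<le> card {[] :: 'a list}"
    by (intro card_mono) (auto simp: tuples_def)
  then show ?case using \<epsilon> by simp
next
  case (Suc J)
  let ?T = "tuples S l" and ?U = "tuples S (l * J)"
  have fin: "finite ?T" "finite ?U" "finite \<B>"
    using finite_tuples[OF S(1)] finite_subset[OF \<B>] by auto
  have pos: "real (card S ^ l) > 0" using S by (simp add: card_gt_0_iff)
  have "real (card {x \<in> tuples S (l * Suc J). P (u @ x @ v)}) = real (\<Sum>y\<in>?T. card {z \<in> ?U. P (u @ (y @ z) @ v)})"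
    by (simp only: mult_Suc_right card_tuples_split[OF S(1)])
  also have "\<dots> = real (\<Sum>y\<in>\<B>. card {z \<in> ?U. P (u @ y @ z @ v)}) + (\<Sum>y\<in>?T - \<B>. real (card {z \<in> ?U. P (u @ y @ z @ v)}))"
    using sum.subset_diff[OF \<B> fin(1), of "\<lambda>y. real (card {z \<in> ?U. P (u @ y @ z @ v)})"] by simp
  \<comment> \<open>When the first block lies in \<open>\<B>\<close>, the later blocks are frozen
    instead and this block varies, so that \<open>bad\<close> applies with right context
    \<open>z @ v\<close>.\<close>
  also have "(\<Sum>y\<in>\<B>. card {z \<in> ?U. P (u @ y @ z @ v)}) = (\<Sum>z\<in>?U. card {y \<in> \<B>. P (u @ y @ z @ v)})"
    by (rule sum_card_swap[OF fin(3,2)])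
  also have "real (\<Sum>z\<in>?U. card {y \<in> \<B>. P (u @ y @ z @ v)}) \<le> (\<Sum>z\<in>?U. \<epsilon> * real (card \<B>))"
    unfolding of_nat_sum
  proof (rule sum_mono)
    fix z assume "z \<in> ?U"
    then have "set (z @ v) \<subseteq> S" using v by (auto simp: tuples_def)
    then show "real (card {y \<in> \<B>. P (u @ y @ z @ v)}) \<le> \<epsilon> * real (card \<B>)"
      using bad[of u "z @ v"] Suc.prems by simp
  qed
  \<comment> \<open>Otherwise the block joins the prefix; this is why the induction is for arbitrary
    \<open>u\<close>.\<close>
  also have "(\<Sum>y\<in>?T - \<B>. real (card {z \<in> ?U. P (u @ y @ z @ v)})) \<le>
      (\<Sum>y\<in>?T - \<B>. (\<epsilon> + \<rho> ^ J) * real (card S ^ (l * J)))"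
  proof (rule sum_mono)
    fix y assume "y \<in> ?T - \<B>"
    then have "set (u @ y) \<subseteq> S" using Suc.prems by (auto simp: tuples_def)
    then show "real (card {z \<in> ?U. P (u @ y @ z @ v)}) \<le> (\<epsilon> + \<rho> ^ J) * real (card S ^ (l * J))"
      using Suc.IH[of "u @ y"] by simp
  qed
  also have "(\<Sum>z\<in>?U. \<epsilon> * real (card \<B>)) + (\<Sum>y\<in>?T - \<B>. (\<epsilon> + \<rho> ^ J) * real (card S ^ (l * J))) =
     real (card S ^ (l * J)) * (\<epsilon> * real (card \<B>) + real (card (?T - \<B>)) * (\<epsilon> + \<rho> ^ J))"
    by (simp add: card_tuples[OF S(1)] algebra_simps)
  \<comment> \<open>As a proportion of all words the bound is \<open>(1 - \<rho>) * \<epsilon> +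
    \<rho> * (\<epsilon> + \<rho> ^ J)\<close>, which equals
    \<open>\<epsilon> + \<rho> ^ Suc J\<close>.\<close>
  also have "real (card (?T - \<B>)) = real (card S ^ l) * \<rho>"
    using pos card_mono[OF fin(1) \<B>] by (simp add: card_Diff_subset[OF fin(3) \<B>] card_tuples[OF S(1)] \<rho> of_nat_diff field_simps)
  also have "real (card \<B>) = real (card S ^ l) * (1 - \<rho>)"
    using pos by (simp add: \<rho>)
  finally show ?case by (simp add: algebra_simps power_add)
qed

text \<open>The tolerance fixes \<open>l\<close> and \<open>\<B>\<close>, hence
  \<open>\<rho> < 1\<close>. Only then does the number of blocks grow, so it does not matter how
  rare the words in \<open>\<B>\<close> are among all words of length \<open>l\<close>.\<close>

lemma bad_fraction_tendsto_0:
  assumes S: "finite S" "S \<noteq> {}"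
    and ex: "\<And>\<epsilon> :: real. \<epsilon> > 0 \<Longrightarrow> \<exists>l \<B>. l > 0 \<and> \<B> \<subseteq> tuples S l \<and> \<B> \<noteq> {} \<and>
      (\<forall>u v. set u \<subseteq> S \<longrightarrow> set v \<subseteq> S \<longrightarrow> real (card {b \<in> \<B>. P (u @ b @ v)}) \<le> \<epsilon> * real (card \<B>))"
  shows "(\<lambda>L. real (card {x \<in> tuples S L. P x}) / real (card (tuples S L))) \<longlonglongrightarrow> 0"
proof (rule LIMSEQ_I)
  fix r :: real assume r: "r > 0"
  obtain l \<B> where l: "l > 0" and \<B>: "\<B> \<subseteq> tuples S l" "\<B> \<noteq> {}"
    and bad': "\<forall>u v. set u \<subseteq> S \<longrightarrow> set v \<subseteq> S \<longrightarrow> real (card {b \<in> \<B>. P (u @ b @ v)}) \<le> r / 2 * real (card \<B>)"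
    using ex[OF half_gt_zero[OF r]] by (elim exE conjE) (rule that)
  have bad: "real (card {b \<in> \<B>. P (u @ b @ v)}) \<le> r / 2 * real (card \<B>)"
    if "set u \<subseteq> S" "set v \<subseteq> S" for u v
    using bad' that by blast
  define \<rho> where "\<rho> = 1 - real (card \<B>) / real (card S ^ l)"
  have pos: "card S ^ L > 0" for L using S by (simp add: card_gt_0_iff)
  have fin: "finite \<B>" using finite_subset[OF \<B>(1) finite_tuples[OF S(1)]] .
  have "card \<B> \<le> card S ^ l" using card_mono[OF finite_tuples[OF S(1)] \<B>(1)] card_tuples[OF S(1)] by simp
  then have "0 \<le> \<rho>" using pos[of l] by (simp add: \<rho>_def field_simps flip: of_nat_power)
  have "card \<B> > 0" using \<B> fin by (simp add: card_gt_0_iff)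
  then have "\<rho> < 1" using pos[of l] by (simp add: \<rho>_def)
  have "(\<lambda>J. \<rho> ^ J) \<longlonglongrightarrow> 0" using \<open>0 \<le> \<rho>\<close> \<open>\<rho> < 1\<close> by (intro LIMSEQ_power_zero) simp
  then obtain J0 where J0: "\<And>J. J \<ge> J0 \<Longrightarrow> \<rho> ^ J < r / 2"
    using LIMSEQ_D[of "\<lambda>J. \<rho> ^ J" 0 "r / 2"] r \<open>0 \<le> \<rho>\<close> by auto
  have "real (card {x \<in> tuples S L. P x}) / real (card (tuples S L)) < r" if L: "L \<ge> l * J0" for L
  proof -
    \<comment> \<open>The \<open>L mod l\<close> letters left over at the end are put into the right
      context.\<close>
    define J m where "J = L div l" and "m = L mod l"
    have Ld: "L = l * J + m" by (simp add: J_def m_def)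
    have J: "J \<ge> J0" using L l by (simp add: J_def less_eq_div_iff_mult_less_eq mult.commute)
    have "real (card {x \<in> tuples S L. P x}) = real (\<Sum>y\<in>tuples S (l * J). card {z \<in> tuples S m. P (y @ z)})"
      unfolding Ld card_tuples_split[OF S(1)] ..
    also have "(\<Sum>y\<in>tuples S (l * J). card {z \<in> tuples S m. P (y @ z)}) =
        (\<Sum>z\<in>tuples S m. card {y \<in> tuples S (l * J). P (y @ z)})"
      by (rule sum_card_swap) (use finite_tuples[OF S(1)] in auto)
    also have "real \<dots> \<le> (\<Sum>z\<in>tuples S m. (r / 2 + \<rho> ^ J) * real (card S ^ (l * J)))"
      unfolding of_nat_sum
    proof (rule sum_mono)
      fix z assume "z \<in> tuples S m"
      then have "set z \<subseteq> S" by (auto simp: tuples_def)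
      then show "real (card {y \<in> tuples S (l * J). P (y @ z)}) \<le> (r / 2 + \<rho> ^ J) * real (card S ^ (l * J))"
        using card_bad_blocks[OF S \<B>(1) _ bad \<rho>_def, of "[]" z J] r by simp
    qed
    also have "\<dots> = (r / 2 + \<rho> ^ J) * real (card S ^ L)"
      by (simp add: card_tuples[OF S(1)] Ld power_add)
    also have "\<dots> < r * real (card S ^ L)"
      using J0[OF J] pos[of L] by (intro mult_strict_right_mono) auto
    finally show ?thesis using pos[of L] by (simp add: card_tuples[OF S(1)] field_simps)
  qed
  then show "\<exists>no. \<forall>L\<ge>no. norm (real (card {x \<in> tuples S L. P x}) / real (card (tuples S L)) - 0) < r"
    by (intro exI[of _ "l * J0"]) auto
qed

section \<open>Words for products of elementary matrices\<close>

lemma addrow_mat_add: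
  assumes "i < n" "j < n" "i \<noteq> j"
  shows "addrow_mat n s i j * addrow_mat n t i j = addrow_mat n (s + t :: 'a :: comm_ring_1) i j"
proof -
  have "addrow_mat n s i j * addrow_mat n t i j = addcol t j i (addrow_mat n s i j)"
    by (rule addcol_mat[symmetric]) (use assms in auto)
  also have "\<dots> = addrow_mat n (s + t) i j"
    using assms by (intro eq_matI) (auto simp: mat_addcol_def addrow_mat_def)
  finally show ?thesis .
qed

lemma addrow_mat_inj:
  "i < n \<Longrightarrow> j < n \<Longrightarrow> i \<noteq> j \<Longrightarrow> addrow_mat n s i j = addrow_mat n t i j \<Longrightarrow> s = (t :: int)"
  by (drule arg_cong[of _ _ "\<lambda>A. A $$ (i, j)"]) simp

lemma abel_mat_transv:
  assumes "i < n" "j < n" "i \<noteq> j"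
  shows "abel_mat n (\<lambda>w. reduce (subst (transv i j True) w)) = addrow_mat n 1 i j"
proof (rule eq_matI)
  fix a c assume "a < dim_row (addrow_mat n 1 i j :: int mat)" "c < dim_col (addrow_mat n 1 i j :: int mat)"
  then have lt: "a < n" "c < n" by simp_all
  have "abel_mat n (\<lambda>w. reduce (subst (transv i j True) w)) $$ (a, c) = expo a (transv i j True c)"
    using lt by (simp add: abel_mat_def)
  also have "\<dots> = addrow_mat n 1 i j $$ (a, c)"
    using lt assms(3) by (cases "c = j") (auto simp: transv_def expo_def)
  finally show "abel_mat n (\<lambda>w. reduce (subst (transv i j True) w)) $$ (a, c) = addrow_mat n 1 i j $$ (a, c)" .
qed (simp_all add: abel_mat_def)

lemma map_transv_prod:
  "map_mat real_of_int (transv_prod n (zip ps ts)) = transv_prod n (zip ps (map real_of_int ts))"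
proof (induction ps arbitrary: ts)
  case Nil
  then show ?case by (simp add: of_int_hom.mat_hom_one)
next
  case (Cons p ps)
  obtain i j where p: "p = (i, j)" by force
  have e: "map_mat real_of_int (addrow_mat n t i j) = addrow_mat n (real_of_int t) i j" for t
    by (intro eq_matI) (auto simp: addrow_mat_def)
  show ?case
  proof (cases ts)
    case (Cons t us)
    then show ?thesis
      using Cons.IH[of us] by (simp add: p of_int_hom.mat_hom_mult[OF addrow_mat_carrier transv_prod_carrier] e)
  qed (simp add: of_int_hom.mat_hom_one)
qed

text \<open>Padding with \<open>inv_word w\<close> makes the length of the words independent of \<open>a\<close>; as a consequence, the
  entries of the elementary matrices run through the progression \<open>-q, -q + 2, \<dots>, q\<close>.\<close>

definition segment :: "(nat \<times> bool) list \<Rightarrow> nat \<Rightarrow> nat \<Rightarrow> (nat \<times> bool) list" where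
  "segment w q a = concat (replicate a w) @ concat (replicate (q - a) (inv_word w))"

fun block :: "(nat \<times> nat \<Rightarrow> (nat \<times> bool) list) \<Rightarrow> nat \<Rightarrow> (nat \<times> nat) list \<Rightarrow> nat list \<Rightarrow> (nat \<times> bool) list" where
  "block w q (p # ps) (a # as) = segment (w p) q a @ block w q ps as"
| "block w q _ _ = []"

lemma length_segment: "a \<le> q \<Longrightarrow> length (segment w q a) = q * length w"
  by (simp add: segment_def length_concat sum_list_replicate diff_mult_distrib)

lemma length_block:
  assumes "length as = length ps" "set as \<subseteq> {..q}"
  shows "length (block w q ps as) = (\<Sum>p\<leftarrow>ps. q * length (w p))"
  using assms by (induction as ps rule: list_induct2) (simp_all add: length_segment)

lemma set_segment: "set (segment w q a) \<subseteq> set w \<union> set (inv_word w)"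
  by (auto simp: segment_def)

lemma set_block:
  assumes "\<And>p x. p \<in> set ps \<Longrightarrow> x \<in> set (w p) \<Longrightarrow> fst x < k"
  shows "\<forall>x\<in>set (block w q ps as). fst x < k"
  using assms
proof (induction w q ps as rule: block.induct)
  case (1 w q p ps a as)
  have "\<forall>x\<in>set (w p). fst x < k" using "1.prems"[of p] by simp
  then have "\<forall>x\<in>set (segment (w p) q a). fst x < k"
    using set_segment[of "w p" q a] fst_inv_word_lt[of "w p" k] by blast
  moreover have "\<forall>x\<in>set (block w q ps as). fst x < k"
    using "1.prems" by (intro "1.IH") (meson list.set_intros(2))
  ultimately show ?case by auto
qed auto

lemma word_mat_segment:
  assumes f: "\<forall>i<k. f i \<in> iso (free_group n) (free_group n)"
    and ij: "i < n" "j < n" "i \<noteq> j"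
    and w: "\<forall>x\<in>set w. fst x < k" "word_mat n f w = addrow_mat n 1 i j"
    and a: "a \<le> q"
  shows "word_mat n f (segment w q a) = addrow_mat n (2 * int a - int q) i j"
proof -
  have rep: "word_mat n f (concat (replicate c u)) = addrow_mat n (int c * t) i j"
    if u: "\<forall>x\<in>set u. fst x < k" "word_mat n f u = addrow_mat n t i j" for c u t
  proof (induction c)
    case (Suc c)
    have "\<forall>x\<in>set (concat (replicate c u)). fst x < k" using u by auto
    then show ?case
      using Suc word_mat_append[OF f u(1)] addrow_mat_add[OF ij] u(2) by (simp add: algebra_simps)
  qed (simp add: addrow_mat_0)
  have lt: "\<forall>x\<in>set (inv_word w). fst x < k" using w(1) by (simp add: fst_inv_word_lt)
  have "word_mat n f (inv_word w) = word_mat n f (inv_word w) * (addrow_mat n 1 i j * addrow_mat n (-1) i j)"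
    by (simp add: addrow_mat_add[OF ij] addrow_mat_0 right_mult_one_mat[OF word_mat_carrier])
  also have "\<dots> = word_mat n f (inv_word w) * addrow_mat n 1 i j * addrow_mat n (-1) i j"
    by (rule assoc_mult_mat[symmetric, OF word_mat_carrier addrow_mat_carrier addrow_mat_carrier])
  also have "\<dots> = addrow_mat n (-1) i j"
    using word_mat_inv_word[OF f w(1)] w(2) by (simp add: left_mult_one_mat[OF addrow_mat_carrier])
  finally have inv: "word_mat n f (inv_word w) = addrow_mat n (-1) i j" .
  have "word_mat n f (segment w q a) =
      word_mat n f (concat (replicate a w)) * word_mat n f (concat (replicate (q - a) (inv_word w)))"
    unfolding segment_def by (rule word_mat_append[OF f]) (use w lt in auto)
  also have "\<dots> = addrow_mat n (2 * int a - int q) i j"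
    using a by (simp add: rep[OF w] rep[OF lt inv] addrow_mat_add[OF ij] of_nat_diff)
  finally show ?thesis .
qed

definition represents_transvections ::
  "nat \<Rightarrow> nat \<Rightarrow> (nat \<Rightarrow> fword \<Rightarrow> fword) \<Rightarrow> (nat \<times> nat \<Rightarrow> (nat \<times> bool) list) \<Rightarrow> bool" where
  "represents_transvections n k f w \<longleftrightarrow> (\<forall>(i, j) \<in> valid_pairs n.
     (\<forall>x\<in>set (w (i, j)). fst x < k) \<and> word_mat n f (w (i, j)) = addrow_mat n 1 i j)"

lemma represents_transvectionsD:
  assumes "represents_transvections n k f w" "(i, j) \<in> valid_pairs n"
  shows "\<forall>x\<in>set (w (i, j)). fst x < k" "word_mat n f (w (i, j)) = addrow_mat n 1 i j"
  using assms by (auto simp: represents_transvections_def)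

lemma set_block_represents:
  assumes "represents_transvections n k f w" "set ps \<subseteq> valid_pairs n"
  shows "\<forall>x\<in>set (block w q ps as). fst x < k"
proof (rule set_block)
  fix p x assume "p \<in> set ps" "x \<in> set (w p)"
  then show "fst x < k" using represents_transvectionsD(1)[OF assms(1), of "fst p" "snd p"] assms(2) by auto
qed

lemma word_mat_block:
  assumes f: "\<forall>i<k. f i \<in> iso (free_group n) (free_group n)"
    and w: "represents_transvections n k f w"
    and ps: "set ps \<subseteq> valid_pairs n" and as: "length as = length ps" "set as \<subseteq> {..q}"
  shows "word_mat n f (block w q ps as) = transv_prod n (zip ps (map (\<lambda>a. 2 * int a - int q) as))"
  using as(1) ps as(2)
proof (induction as ps rule: list_induct2)
  case (Cons a as p ps)
  obtain i j where p: "p = (i, j)" by force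
  have ij: "(i, j) \<in> valid_pairs n" using Cons p by auto
  have "\<forall>x\<in>set (segment (w p) q a). fst x < k"
    using set_segment[of "w p" q a] fst_inv_word_lt[of "w p" k] represents_transvectionsD(1)[OF w ij] p
    by blast
  moreover have "\<forall>x\<in>set (block w q ps as). fst x < k"
    using Cons.prems by (intro set_block_represents[OF w]) auto
  moreover have "word_mat n f (segment (w p) q a) = addrow_mat n (2 * int a - int q) i j"
    by (rule word_mat_segment[OF f]) (use ij p represents_transvectionsD[OF w ij] Cons.prems in \<open>auto simp: valid_pairs_def\<close>)
  ultimately show ?case using Cons by (simp add: p word_mat_append[OF f])
qed simp

text \<open>Identifies the uniform distribution on blocks with the one on parameter tuples. Segment
  lengths do not depend on the parameters, so a block splits uniquely, and the matrix of each
  segment reveals its parameter.\<close>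

lemma block_inj:
  assumes f: "\<forall>i<k. f i \<in> iso (free_group n) (free_group n)"
    and w: "represents_transvections n k f w"
    and ps: "set ps \<subseteq> valid_pairs n"
  shows "inj_on (block w q ps) (tuples {..q} (length ps))"
proof -
  have "as = bs" if "as \<in> tuples {..q} (length ps)" "bs \<in> tuples {..q} (length ps)"
    "block w q ps as = block w q ps bs" for as bs
    using that ps
  proof (induction ps arbitrary: as bs)
    case (Cons p ps)
    obtain a as' b bs' where as: "as = a # as'" and bs: "bs = b # bs'"
      using Cons.prems by (cases as; cases bs) (auto simp: tuples_def)
    obtain i j where p: "p = (i, j)" by force
    have ij: "(i, j) \<in> valid_pairs n" using Cons p by auto
    have le: "a \<le> q" "b \<le> q" using Cons.prems as bs by (auto simp: tuples_def)
    have eq: "segment (w p) q a = segment (w p) q b" "block w q ps as' = block w q ps bs'"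
      using Cons.prems(3) le by (auto simp: as bs length_segment append_eq_append_conv)
    have ij': "i < n" "j < n" "i \<noteq> j" using ij by (auto simp: valid_pairs_def)
    have seg: "word_mat n f (segment (w p) q c) = addrow_mat n (2 * int c - int q) i j" if "c \<le> q" for c
      by (rule word_mat_segment[OF f ij']) (use p represents_transvectionsD[OF w ij] that in auto)
    then have "addrow_mat n (2 * int a - int q) i j = addrow_mat n (2 * int b - int q) i j"
      using seg[OF le(1)] seg[OF le(2)] eq(1) by simp
    then have "2 * int a - int q = 2 * int b - int q" by (rule addrow_mat_inj[OF ij'])
    moreover have "as' = bs'" using Cons.IH[OF _ _ eq(2)] Cons.prems as bs by (auto simp: tuples_def)
    ultimately show ?case by (simp add: as bs)
  qed (simp add: tuples_def)
  then show ?thesis by (auto intro!: inj_onI)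
qed

lemma det_unit_real:
  assumes "A \<in> carrier_mat n n" "B \<in> carrier_mat n n" "A * B = (1\<^sub>m n :: int mat)"
  shows "\<bar>det (map_mat real_of_int A)\<bar> = 1"
proof -
  have "det A * det B = 1" using det_mult[OF assms(1,2)] assms(3) by simp
  then have "\<bar>det A\<bar> = 1" by (metis abs_zmult_eq_1 abs_one)
  then show ?thesis by (metis of_int_1 of_int_abs of_int_hom.hom_det)
qed

text \<open>The context enters only through the matrices of \<open>u\<close> and \<open>v\<close>,
  which have determinant \<plusminus>1, and the bound is the same for all of them. This uniformity
  is what allows conditioning on everything outside the block.\<close>

lemma block_resonance_bound:
  assumes n: "n \<ge> 2" and e: "e \<ge> 1"
    and f: "\<forall>i<k. f i \<in> iso (free_group n) (free_group n)"
    and w: "represents_transvections n k f w"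
    and ps: "set ps \<subseteq> valid_pairs n" "universal n ps"
    and uv: "\<forall>x\<in>set u. fst x < k" "\<forall>x\<in>set v. fst x < k"
  shows "card {b \<in> block w q ps ` tuples {..q} (length ps). resonance n e (word_mat n f (u @ b @ v)) = 0} * Suc q
    \<le> length ps * resonance_degree n e * Suc q ^ length ps"
proof -
  define N where "N = length ps"
  define h where "h a = 2 * real a - real q" for a
  define A B where "A = map_mat real_of_int (word_mat n f u)" and "B = map_mat real_of_int (word_mat n f v)"
  let ?F = "\<lambda>ts. resonance n e (A * transv_prod n (zip ps ts) * B)"
  let ?I = "tuples {..q} N" and ?S = "h ` {..q}"
  have AB: "A \<in> carrier_mat n n" "B \<in> carrier_mat n n" by (simp_all add: A_def B_def)
  have hinj: "inj h" by (auto simp: inj_def h_def)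
  have cardS: "card ?S = Suc q" using card_image[OF inj_on_subset[OF hinj]] by simp
  have lt: "\<forall>x\<in>set (inv_word u). fst x < k" "\<forall>x\<in>set (inv_word v). fst x < k"
    using uv by (simp_all add: fst_inv_word_lt)
  have right: "word_mat n f x * word_mat n f (inv_word x) = 1\<^sub>m n" if "\<forall>y\<in>set x. fst y < k" for x
    using word_mat_inv_word[OF f, of "inv_word x"] that by (simp add: fst_inv_word_lt)
  have "\<exists>ts. length ts = length ps \<and> ?F ts \<noteq> 0"
  proof (rule resonance_nonzero_somewhere[OF n e AB(1) _ _ _ AB(2) _ _ _ ps(2)])
    show "A * map_mat real_of_int (word_mat n f (inv_word u)) = 1\<^sub>m n"
      unfolding A_def of_int_hom.mat_hom_mult[OF word_mat_carrier word_mat_carrier, symmetric]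
      by (simp add: right uv of_int_hom.mat_hom_one)
    show "map_mat real_of_int (word_mat n f (inv_word v)) * B = 1\<^sub>m n"
      unfolding B_def of_int_hom.mat_hom_mult[OF word_mat_carrier word_mat_carrier, symmetric]
      by (simp add: word_mat_inv_word[OF f] uv of_int_hom.mat_hom_one)
    show "\<bar>det A\<bar> = 1" "\<bar>det B\<bar> = 1"
      unfolding A_def B_def by (rule det_unit_real[OF word_mat_carrier word_mat_carrier right]; fact uv)+
  qed auto
  then obtain ts where "length ts = N" "?F ts \<noteq> 0" by (auto simp: N_def)
  \<comment> \<open>The point \<open>ts\<close> may lie off the grid \<open>?S\<close>, which enters
    the bound only through its \<open>Suc q\<close> elements.\<close>
  then have SZ: "card {ts \<in> tuples ?S N. ?F ts = 0} * Suc q \<le> N * resonance_degree n e * Suc q ^ N"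
    using schwartz_zippel[OF separately_poly_resonance[OF AB, of e ps], of ts ?S] cardS by (simp add: N_def)
  have F: "real_of_int (resonance n e (word_mat n f (u @ block w q ps as @ v))) = ?F (map h as)"
    if as: "as \<in> ?I" for as
  proof -
    have as': "length as = length ps" "set as \<subseteq> {..q}" using as by (auto simp: tuples_def N_def)
    let ?b = "block w q ps as"
    have b: "\<forall>x\<in>set ?b. fst x < k" by (rule set_block_represents[OF w ps(1)])
    have "map_mat real_of_int (word_mat n f ?b) = transv_prod n (zip ps (map h as))"
      using word_mat_block[OF f w ps(1) as'] by (simp add: map_transv_prod o_def h_def[abs_def])
    moreover have "word_mat n f (u @ ?b @ v) = word_mat n f u * word_mat n f ?b * word_mat n f v"
      using word_mat_append[OF f uv(1), of "?b @ v"] word_mat_append[OF f b uv(2)] uv b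
      by (simp add: ball_Un assoc_mult_mat[OF word_mat_carrier word_mat_carrier word_mat_carrier])
    moreover have "map_mat real_of_int (word_mat n f u * word_mat n f ?b * word_mat n f v) =
        A * map_mat real_of_int (word_mat n f ?b) * B"
      unfolding A_def B_def
      by (simp add: of_int_hom.mat_hom_mult[OF mult_carrier_mat[OF word_mat_carrier word_mat_carrier] word_mat_carrier]
          of_int_hom.mat_hom_mult[OF word_mat_carrier word_mat_carrier])
    ultimately show ?thesis
      using resonance_of_int[OF word_mat_carrier, of n e f "u @ ?b @ v"] by simp
  qed
  have fin: "finite {ts \<in> tuples ?S N. ?F ts = 0}" using finite_tuples[of ?S N] by simp
  have "card {b \<in> block w q ps ` ?I. resonance n e (word_mat n f (u @ b @ v)) = 0}
      \<le> card (block w q ps ` {as \<in> ?I. ?F (map h as) = 0})"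
    using F finite_tuples[of "{..q}" N]
    by (intro card_mono) (auto simp flip: F)
  also have "\<dots> \<le> card {as \<in> ?I. ?F (map h as) = 0}"
    using finite_tuples[of "{..q}" N] by (intro card_image_le) simp
  also have "\<dots> \<le> card {ts \<in> tuples ?S N. ?F ts = 0}"
  proof (rule card_inj_on_le[where f = "map h", OF _ _ fin])
    show "inj_on (map h) {as \<in> ?I. ?F (map h as) = 0}"
      by (rule inj_on_subset[OF inj_mapI[OF hinj] subset_UNIV])
    show "map h ` {as \<in> ?I. ?F (map h as) = 0} \<subseteq> {ts \<in> tuples ?S N. ?F ts = 0}"
    proof
      fix ts assume "ts \<in> map h ` {as \<in> ?I. ?F (map h as) = 0}"
      then obtain as where as: "ts = map h as" "as \<in> ?I" "?F ts = 0" by blast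
      have "set ts \<subseteq> ?S" using as(2) unfolding as(1) set_map tuples_def by blast
      then show "ts \<in> {ts \<in> tuples ?S N. ?F ts = 0}" using as by (simp add: tuples_def)
    qed
  qed
  finally have "card {b \<in> block w q ps ` ?I. resonance n e (word_mat n f (u @ b @ v)) = 0} * Suc q
      \<le> card {ts \<in> tuples ?S N. ?F ts = 0} * Suc q" by (rule mult_right_mono) simp
  then show ?thesis using SZ unfolding N_def by linarith
qed

section \<open>Convergence of the proportions\<close>

lemma transvection_words:
  assumes gen: "\<forall>\<phi>\<in>iso (free_group n) (free_group n). \<exists>w. (\<forall>x\<in>set w. fst x < k) \<and>
      (\<forall>x\<in>carrier (free_group n). eval_aut_word n f w x = \<phi> x)"
  obtains w where "represents_transvections n k f w"
proof -
  have "\<exists>w. (\<forall>x\<in>set w. fst x < k) \<and> word_mat n f w = addrow_mat n 1 (fst p) (snd p)"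
    if "p \<in> valid_pairs n" for p
  proof -
    have ij: "fst p < n" "snd p < n" "fst p \<noteq> snd p" using that by (auto simp: valid_pairs_def)
    obtain w where w: "\<forall>x\<in>set w. fst x < k"
      "\<forall>x\<in>carrier (free_group n). eval_aut_word n f w x = reduce (subst (transv (fst p) (snd p) True) x)"
      using bspec[OF gen transv_iso[OF ij]] by (elim exE conjE) (rule that)
    have "word_mat n f w = addrow_mat n 1 (fst p) (snd p)"
      unfolding word_mat_def abel_mat_transv[OF ij, symmetric] by (rule abel_mat_cong) (use w in simp)
    then show ?thesis using w(1) by blast
  qed
  then obtain w where "\<And>p. p \<in> valid_pairs n \<Longrightarrow>
      (\<forall>x\<in>set (w p). fst x < k) \<and> word_mat n f (w p) = addrow_mat n 1 (fst p) (snd p)" by metis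
  then have "represents_transvections n k f w" by (auto simp: represents_transvections_def)
  then show thesis by (rule that)
qed

lemma resonance_fraction_tendsto_0:
  assumes n: "n \<ge> 2" and e: "e \<ge> 1"
    and f: "\<forall>i<k. f i \<in> iso (free_group n) (free_group n)"
    and gen: "\<forall>\<phi>\<in>iso (free_group n) (free_group n). \<exists>w. (\<forall>x\<in>set w. fst x < k) \<and>
      (\<forall>x\<in>carrier (free_group n). eval_aut_word n f w x = \<phi> x)"
  defines "S \<equiv> {..<k} \<times> (UNIV :: bool set)"
  shows "S \<noteq> {}"
    and "(\<lambda>L. real (card {x \<in> tuples S L. resonance n e (word_mat n f x) = 0}) / real (card (tuples S L))) \<longlonglongrightarrow> 0"
proof -
  obtain w where w: "represents_transvections n k f w" using transvection_words[OF gen] by metis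
  \<comment> \<open>The empty word has the identity matrix. Nonempty words yield a nonempty alphabet
    and, later, a positive block length.\<close>
  have ne: "w (i, j) \<noteq> []" if "(i, j) \<in> valid_pairs n" for i j
  proof
    assume "w (i, j) = []"
    then have "addrow_mat n 0 i j = (addrow_mat n 1 i j :: int mat)" using represents_transvectionsD(2)[OF w that] by (simp add: addrow_mat_0)
    then show False using addrow_mat_inj[of i n j 0 1] that by (auto simp: valid_pairs_def)
  qed
  have 01: "(0, 1) \<in> valid_pairs n" using n by (simp add: valid_pairs_def)
  obtain x where "x \<in> set (w (0, 1))" using ne[OF 01] by (meson list.set_sel(1))
  then show S: "S \<noteq> {}" using represents_transvectionsD(1)[OF w 01] by (fastforce simp: S_def)
  have finS: "finite S" by (simp add: S_def)
  have inS: "set u \<subseteq> S \<longleftrightarrow> (\<forall>x\<in>set u. fst x < k)" for u by (auto simp: S_def)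
  obtain ps where ps: "set ps \<subseteq> valid_pairs n"
    and univ: "universal n ps"
    using universal_pattern[of n] n by auto
  have psne: "ps \<noteq> []"
  proof
    assume "ps = []"
    moreover have "det (addrow_mat n 1 0 1 :: real mat) = 1" by (simp add: det_addrow_mat)
    ultimately have "addrow_mat n 1 0 1 = (1\<^sub>m n :: real mat)"
      using univ addrow_mat_carrier[of n 1 0 1] unfolding universal_def by fastforce
    then have "(addrow_mat n 1 0 1 :: real mat) $$ (0, 1) = 1\<^sub>m n $$ (0, 1)" by simp
    then show False using n by simp
  qed
  let ?d = "resonance_degree n e" and ?N = "length ps"
  show "(\<lambda>L. real (card {x \<in> tuples S L. resonance n e (word_mat n f x) = 0}) / real (card (tuples S L))) \<longlonglongrightarrow> 0"
  proof (rule bad_fraction_tendsto_0[OF finS S])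
    fix \<epsilon> :: real assume \<epsilon>: "\<epsilon> > 0"
    obtain q0 :: nat where q0: "real (?N * ?d) / \<epsilon> < real q0" using reals_Archimedean2 by blast
    \<comment> \<open>Schwartz--Zippel bounds the bad proportion by \<open>?N * ?d / Suc q\<close>,
      which is now at most \<open>\<epsilon>\<close>. The successor ensures \<open>q > 0\<close>;
      with \<open>q = 0\<close> every block would be empty.\<close>
    define q where "q = Suc q0"
    have q: "real (?N * ?d) \<le> \<epsilon> * real (Suc q)"
      using q0 \<epsilon> by (simp add: q_def field_simps)
    define l where "l = (\<Sum>p\<leftarrow>ps. q * length (w p))"
    define \<B> where "\<B> = block w q ps ` tuples {..q} ?N"
    have card\<B>: "card \<B> = Suc q ^ ?N"
      unfolding \<B>_def using card_image[OF block_inj[OF f w ps]] card_tuples[of "{..q}" ?N] by simp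
    obtain p ps' where p: "ps = p # ps'" using psne by (cases ps) auto
    have "q * length (w p) \<noteq> 0" using ne[of "fst p" "snd p"] ps p by (auto simp: q_def)
    then have "l > 0" by (simp add: l_def p)
    moreover have "\<B> \<subseteq> tuples S l"
    proof
      fix b assume "b \<in> \<B>"
      then obtain as where as: "as \<in> tuples {..q} ?N" "b = block w q ps as" by (auto simp: \<B>_def)
      have "\<forall>x\<in>set b. fst x < k" unfolding as(2) by (rule set_block_represents[OF w ps])
      moreover have "length b = l" unfolding as(2) l_def by (rule length_block) (use as in \<open>auto simp: tuples_def\<close>)
      ultimately show "b \<in> tuples S l" using inS[of b] by (simp add: tuples_def)
    qed
    moreover have "\<B> \<noteq> {}" using card\<B> by auto
    moreover have "real (card {b \<in> \<B>. resonance n e (word_mat n f (u @ b @ v)) = 0}) \<le> \<epsilon> * real (card \<B>)"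
      if "set u \<subseteq> S" "set v \<subseteq> S" for u v
    proof -
      have "card {b \<in> \<B>. resonance n e (word_mat n f (u @ b @ v)) = 0} * Suc q \<le> ?N * ?d * Suc q ^ ?N"
        unfolding \<B>_def using that inS by (intro block_resonance_bound[OF n e f w ps univ]) auto
      then have "real (card {b \<in> \<B>. resonance n e (word_mat n f (u @ b @ v)) = 0} * Suc q) \<le> real (?N * ?d * Suc q ^ ?N)"
        by (simp only: of_nat_le_iff)
      then have "real (card {b \<in> \<B>. resonance n e (word_mat n f (u @ b @ v)) = 0}) * real (Suc q)
          \<le> real (?N * ?d) * real (card \<B>)"
        by (simp only: card\<B> of_nat_mult)
      also have "\<dots> \<le> \<epsilon> * real (Suc q) * real (card \<B>)" using q by (rule mult_right_mono) simp
      finally have "real (card {b \<in> \<B>. resonance n e (word_mat n f (u @ b @ v)) = 0}) * real (Suc q)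
          \<le> (\<epsilon> * real (card \<B>)) * real (Suc q)" by (simp add: mult_ac)
      then show ?thesis by (rule mult_right_le_imp_le) simp
    qed
    ultimately show "\<exists>l \<B>. l > 0 \<and> \<B> \<subseteq> tuples S l \<and> \<B> \<noteq> {} \<and>
      (\<forall>u v. set u \<subseteq> S \<longrightarrow> set v \<subseteq> S \<longrightarrow>
        real (card {b \<in> \<B>. resonance n e (word_mat n f (u @ b @ v)) = 0}) \<le> \<epsilon> * real (card \<B>))"
      by blast
  qed
qed

lemma good_fraction_tendsto_1:
  assumes S: "finite S" "S \<noteq> {}"
    and bad: "(\<lambda>L. real (card {x \<in> tuples S L. P x}) / real (card (tuples S L))) \<longlonglongrightarrow> 0"
    and imp: "\<And>x. set x \<subseteq> S \<Longrightarrow> \<not> Q x \<Longrightarrow> P x"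
  shows "(\<lambda>L. real (card {x \<in> tuples S L. Q x}) / real (card (tuples S L))) \<longlonglongrightarrow> 1"
proof (rule tendsto_sandwich[where h = "\<lambda>_. 1"])
  have "card S > 0" using S by (simp add: card_gt_0_iff)
  then have pos: "card (tuples S L) > 0" for L by (simp add: card_tuples[OF S(1)])
  show "(\<lambda>L. 1 - real (card {x \<in> tuples S L. P x}) / real (card (tuples S L))) \<longlonglongrightarrow> 1"
    using tendsto_diff[OF tendsto_const[of 1] bad] by simp
  show "\<forall>\<^sub>F L in sequentially. real (card {x \<in> tuples S L. Q x}) / real (card (tuples S L)) \<le> 1"
  proof (intro always_eventually allI)
    fix L
    have "card {x \<in> tuples S L. Q x} \<le> card (tuples S L)"
      by (intro card_mono finite_tuples S) auto
    then show "real (card {x \<in> tuples S L. Q x}) / real (card (tuples S L)) \<le> 1"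
      using pos[of L] by simp
  qed
  show "\<forall>\<^sub>F L in sequentially. 1 - real (card {x \<in> tuples S L. P x}) / real (card (tuples S L))
      \<le> real (card {x \<in> tuples S L. Q x}) / real (card (tuples S L))"
  proof (intro always_eventually allI)
    fix L
    have fin: "finite (tuples S L)" by (rule finite_tuples[OF S(1)])
    have "card (tuples S L) \<le> card ({x \<in> tuples S L. P x} \<union> {x \<in> tuples S L. Q x})"
    proof (rule card_mono)
      show "finite ({x \<in> tuples S L. P x} \<union> {x \<in> tuples S L. Q x})" using fin by simp
      show "tuples S L \<subseteq> {x \<in> tuples S L. P x} \<union> {x \<in> tuples S L. Q x}"
        using imp by (auto simp: tuples_def)
    qed
    also have "\<dots> \<le> card {x \<in> tuples S L. P x} + card {x \<in> tuples S L. Q x}" by (rule card_Un_le)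
    finally have "real (card (tuples S L)) \<le> real (card {x \<in> tuples S L. P x}) + real (card {x \<in> tuples S L. Q x})"
      by linarith
    then have "1 \<le> (real (card {x \<in> tuples S L. P x}) + real (card {x \<in> tuples S L. Q x})) / real (card (tuples S L))"
      using pos[of L] by simp
    then show "1 - real (card {x \<in> tuples S L. P x}) / real (card (tuples S L))
      \<le> real (card {x \<in> tuples S L. Q x}) / real (card (tuples S L))"
      by (simp add: add_divide_distrib)
  qed
qed simp

theorem theorem10p1:
  fixes n k :: nat and f :: "nat \<Rightarrow> fword \<Rightarrow> fword"
  assumes "n \<ge> 2"
    and "\<forall>i<k. f i \<in> iso (free_group n) (free_group n)"
    and "\<forall>\<phi>\<in>iso (free_group n) (free_group n). \<exists>w. (\<forall>x\<in>set w. fst x < k) \<and>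
            (\<forall>x\<in>carrier (free_group n). eval_aut_word n f w x = \<phi> x)"
  shows "(\<lambda>L. real (card {w \<in> gen_words k L. irreducible_aut n (eval_aut_word n f w)})
              / real (card (gen_words k L))) \<longlonglongrightarrow> 1 \<and>
         (\<lambda>L. real (card {w \<in> gen_words k L. strongly_irreducible_aut n (eval_aut_word n f w)})
              / real (card (gen_words k L))) \<longlonglongrightarrow> 1"
proof -
  let ?S = "{..<k} \<times> (UNIV :: bool set)"
  obtain e where e: "e \<ge> 1" "\<forall>M\<in>carrier_mat n n. \<forall>M'\<in>carrier_mat n n. M' * M = 1\<^sub>m n \<longrightarrow>
    modm 15 (M ^\<^sub>m e) = modm 15 (1\<^sub>m n)"
    using uniform_exponent_mod[of 15 n, OF zero_less_numeral] by (elim exE conjE) (rule that)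
  note lim = resonance_fraction_tendsto_0[OF assms(1) e(1) assms(2,3)]
  have gw: "gen_words k L = tuples ?S L" for L by (auto simp: gen_words_def tuples_def)
  \<comment> \<open>Failure of either kind of irreducibility leads to the same equation, so one
    limit serves both claims.\<close>
  have bad: "resonance n e (word_mat n f w) = 0"
    if w: "set w \<subseteq> ?S" and red: "\<not> irreducible_aut n (eval_aut_word n f w) \<or> \<not> strongly_irreducible_aut n (eval_aut_word n f w)" for w
  proof -
    have lt: "\<forall>x\<in>set w. fst x < k" using w by auto
    have iso: "eval_aut_word n f w \<in> iso (free_group n) (free_group n)"
      by (rule eval_aut_word_iso[OF assms(2) lt])
    obtain m r where "m \<ge> 1" "0 < r" "r < n" "preserves_summand n r (word_mat n f w ^\<^sub>m m)"
      using red not_irreducible_imp[OF iso] not_strongly_irreducible_imp[OF iso]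
      unfolding word_mat_def by blast
    moreover have "modm 15 (word_mat n f w ^\<^sub>m e) = modm 15 (1\<^sub>m n)"
      using e(2) word_mat_carrier word_mat_inv_word[OF assms(2) lt] by blast
    ultimately show ?thesis using resonance_zero[OF word_mat_carrier] by blast
  qed
  show ?thesis
    unfolding gw by (intro conjI good_fraction_tendsto_1[OF _ lim(1) lim(2)] bad) auto
qed

end
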